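(* Let $\Omega$ and $\Omega'$ be localizable measure spaces. Suppose $1\le p<\infty$. Let $T\colon L^p(\Omega)\to L^p(\Omega')$ be a regular operator. Then the map $$\begin{bmatrix} |T| & T\\ T^\circ & |T|\end{bmatrix}\colon S^p_2(L^p(\Omega))\to S^p_2(L^p(\Omega')),\quad \begin{bmatrix} a&b\\ c&d\end{bmatrix}\mapsto \begin{bmatrix} |T|(a)&T(b)\\ T^\circ(c)&|T|(d)\end{bmatrix}$$ is completely positive, i.e. the infimum defining $\|T\|_{\mathrm{dec},L^p(\Omega)\to L^p(\Omega')}$ is attained with $v_1=v_2=|T|$.
   Context: A measure space $\Omega$ is localizable if its measure algebra is semifinite and Dedekind complete; equivalently, the canonical map $L^\infty(\Omega)\to L^1(\Omega)^*$ is bijective. Then $L^\infty(\Omega)$ is a von Neumann algebra with semifinite faithful normal trace given by integration, and its $L^p$-space is $L^p(\Omega)$. $L^p$-spaces are complex. A linear map $T\colon L^p(\Omega)\to L^p(\Omega')$ is regular if $\sup_X\|T\otimes\mathrm{Id}_X\|_{L^p(\Omega,X)\to L^p(\Omega',X)}<\infty$, the supremum being over all Banach spaces $X$ (Bochner spaces). Its absolute value (modulus) $|T|$ is the positive operator determined by $|T|(f)=\sup\{|T(g)| : |g|\le f\}$ for positive $f\in L^p(\Omega)$. Put $T^\circ(x)=T(x^* )^*$, i.e. $T^\circ(f)=\overline{T(\overline f)}$. For a von Neumann algebra $M$ with faithful normal semifinite trace $\tau$, $S^p_n(L^p(M)) = L^p(M_n(M),\mathrm{Tr}\otimes\tau)$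 with its usual positive cone (for $M=L^\infty(\Omega)$ this is $L^p(\Omega,S^p_n)$). A map between such spaces is completely positive if all its amplifications by $\mathrm{Id}_{M_n}$, $n\ge1$, are positive. A linear map $T\colon L^p(M)\to L^p(N)$ is decomposable if there are linear maps $v_1,v_2\colon L^p(M)\to L^p(N)$ such that $\begin{bmatrix} v_1 & T\\ T^\circ & v_2\end{bmatrix}\colon S^p_2(L^p(M))\to S^p_2(L^p(N))$ (acting entrywise) is completely positive, and $\|T\|_{\mathrm{dec}}=\inf\max\{\|v_1\|,\|v_2\|\}$ over all such $v_1,v_2$. *)

theory Defs
  imports "HOL-Analysis.Analysis"
begin

section \<open>Localizable measure spaces\<close>

text \<open>
  Elements of the measure algebra of \<open>M\<close> are represented by measurable sets modulo null sets;
  \<open>A\<close> is below \<open>B\<close> in the measure algebra iff \<open>A - B\<close> is null.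
\<close>

definition malg_le :: "'a measure \<Rightarrow> 'a set \<Rightarrow> 'a set \<Rightarrow> bool" where
  "malg_le M A B \<longleftrightarrow> A - B \<in> null_sets M"

definition malg_dedekind_complete :: "'a measure \<Rightarrow> bool" where
  "malg_dedekind_complete M \<longleftrightarrow>
     (\<forall>\<A>. \<A> \<subseteq> sets M \<longrightarrow>
       (\<exists>E\<in>sets M. (\<forall>A\<in>\<A>. malg_le M A E) \<and>
          (\<forall>F\<in>sets M. (\<forall>A\<in>\<A>. malg_le M A F) \<longrightarrow> malg_le M E F)))"

text \<open>
  The library locale \<open>semifinite_measure\<close> is not used: it does not require the subset \<open>B\<close> to
  have positive measure, so it is satisfied by every measure (take \<open>B\<close> empty).
\<close>

definition malg_semifinite :: "'a measure \<Rightarrow> bool" where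
  "malg_semifinite M \<longleftrightarrow>
     (\<forall>A\<in>sets M. emeasure M A = \<infinity> \<longrightarrow>
       (\<exists>B\<in>sets M. B \<subseteq> A \<and> 0 < emeasure M B \<and> emeasure M B < \<infinity>))"

definition localizable :: "'a measure \<Rightarrow> bool" where
  "localizable M \<longleftrightarrow> malg_semifinite M \<and> malg_dedekind_complete M"

section \<open>Complex \<open>L\<^sup>p\<close>-spaces and their operators\<close>

text \<open>
  An element of \<open>L\<^sup>p(M)\<close> is represented by a \<open>p\<close>-integrable measurable function, and equality, order
  and linearity are understood almost everywhere.  A linear map between \<open>L\<^sup>p\<close>-spaces is
  represented by a function on representatives that respects almost everywhere equality.
  On \<open>complex\<close>, \<open>x \<le> y\<close> means that \<open>y - x\<close> is a nonnegative real number.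
\<close>

definition Lp :: "real \<Rightarrow> 'a measure \<Rightarrow> ('a \<Rightarrow> complex) set" where
  "Lp p M = {f \<in> borel_measurable M. integrable M (\<lambda>x. norm (f x) powr p)}"

definition Lp_norm :: "real \<Rightarrow> 'a measure \<Rightarrow> ('a \<Rightarrow> complex) \<Rightarrow> real" where
  "Lp_norm p M f = (\<integral>x. norm (f x) powr p \<partial>M) powr (1 / p)"

definition Lp_linear ::
  "real \<Rightarrow> 'a measure \<Rightarrow> 'b measure \<Rightarrow> (('a \<Rightarrow> complex) \<Rightarrow> 'b \<Rightarrow> complex) \<Rightarrow> bool" where
  "Lp_linear p M N T \<longleftrightarrow>
     (\<forall>f\<in>Lp p M. T f \<in> Lp p N) \<and>
     (\<forall>f\<in>Lp p M. \<forall>g\<in>Lp p M. (AE x in M. f x = g x) \<longrightarrow> (AE y in N. T f y = T g y)) \<and>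
     (\<forall>f\<in>Lp p M. \<forall>g\<in>Lp p M. AE y in N. T (\<lambda>x. f x + g x) y = T f y + T g y) \<and>
     (\<forall>c. \<forall>f\<in>Lp p M. AE y in N. T (\<lambda>x. c * f x) y = c * T f y)"

text \<open>Operator norms take values in \<open>ennreal\<close>; the value is \<open>\<infinity>\<close> for unbounded maps.\<close>

definition Lp_opnorm ::
  "real \<Rightarrow> 'a measure \<Rightarrow> 'b measure \<Rightarrow> (('a \<Rightarrow> complex) \<Rightarrow> 'b \<Rightarrow> complex) \<Rightarrow> ennreal" where
  "Lp_opnorm p M N T =
     Inf {C. \<forall>f\<in>Lp p M. ennreal (Lp_norm p N (T f)) \<le> C * ennreal (Lp_norm p M f)}"

definition Lp_positive ::
  "real \<Rightarrow> 'a measure \<Rightarrow> 'b measure \<Rightarrow> (('a \<Rightarrow> complex) \<Rightarrow> 'b \<Rightarrow> complex) \<Rightarrow> bool" where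
  "Lp_positive p M N T \<longleftrightarrow>
     (\<forall>f\<in>Lp p M. (AE x in M. 0 \<le> f x) \<longrightarrow> (AE y in N. 0 \<le> T f y))"

section \<open>Regular operators\<close>

text \<open>
  HOL cannot quantify over all Banach spaces inside a formula, so a universe has to be fixed.
  Here a complex Banach space is a linear subspace \<open>V\<close> of \<open>\<complex>\<^sup>\<nat>\<close> (with the pointwise operations)
  together with an arbitrary complete norm \<open>\<nu>\<close> on \<open>V\<close>, unrelated to the topology of \<open>\<complex>\<^sup>\<nat>\<close>.
  Every separable Banach space, more generally every one of Hamel dimension at most the
  continuum, is isometrically isomorphic to such a pair.  As each element of
  \<open>L\<^sup>p(\<Omega>) \<otimes> X\<close> lies in \<open>L\<^sup>p(\<Omega>) \<otimes> X\<^sub>0\<close> for some finite-dimensional \<open>X\<^sub>0 \<subseteq> X\<close>, the supremum over this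
  universe equals the supremum over all Banach spaces.
\<close>

definition complex_banach :: "(nat \<Rightarrow> complex) set \<Rightarrow> ((nat \<Rightarrow> complex) \<Rightarrow> real) \<Rightarrow> bool" where
  "complex_banach V \<nu> \<longleftrightarrow>
     (\<lambda>_. 0) \<in> V \<and>
     (\<forall>u\<in>V. \<forall>v\<in>V. (\<lambda>k. u k + v k) \<in> V) \<and>
     (\<forall>c. \<forall>v\<in>V. (\<lambda>k. c * v k) \<in> V) \<and>
     (\<forall>v\<in>V. 0 \<le> \<nu> v) \<and>
     (\<forall>v\<in>V. \<nu> v = 0 \<longleftrightarrow> v = (\<lambda>_. 0)) \<and>
     (\<forall>c. \<forall>v\<in>V. \<nu> (\<lambda>k. c * v k) = norm c * \<nu> v) \<and>
     (\<forall>u\<in>V. \<forall>v\<in>V. \<nu> (\<lambda>k. u k + v k) \<le> \<nu> u + \<nu> v) \<and>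
     (\<forall>s. (\<forall>i. s i \<in> V) \<and>
          (\<forall>e>0. \<exists>n0. \<forall>m\<ge>n0. \<forall>n\<ge>n0. \<nu> (\<lambda>k. s m k - s n k) < e) \<longrightarrow>
        (\<exists>v\<in>V. (\<lambda>n. \<nu> (\<lambda>k. s n k - v k)) \<longlonglongrightarrow> 0))"

text \<open>The function \<open>\<Sum>i<n. f i \<otimes> x i\<close> with values in the vector space \<open>X \<subseteq> \<complex>\<^sup>\<nat>\<close>:\<close>

definition tensor_sum ::
  "nat \<Rightarrow> (nat \<Rightarrow> 'a \<Rightarrow> complex) \<Rightarrow> (nat \<Rightarrow> nat \<Rightarrow> complex) \<Rightarrow> 'a \<Rightarrow> nat \<Rightarrow> complex" where
  "tensor_sum n f x = (\<lambda>\<omega> k. \<Sum>i<n. f i \<omega> * x i k)"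

text \<open>The norm of the Bochner space \<open>L\<^sup>p(M, X)\<close>, where \<open>\<nu>\<close> is the norm of \<open>X\<close>:\<close>

definition Bochner_norm ::
  "real \<Rightarrow> 'a measure \<Rightarrow> ((nat \<Rightarrow> complex) \<Rightarrow> real) \<Rightarrow> ('a \<Rightarrow> nat \<Rightarrow> complex) \<Rightarrow> real" where
  "Bochner_norm p M \<nu> F = (\<integral>\<omega>. \<nu> (F \<omega>) powr p \<partial>M) powr (1 / p)"

text \<open>
  The norm of \<open>T \<otimes> Id\<^sub>X : L\<^sup>p(M, X) \<rightarrow> L\<^sup>p(N, X)\<close>.  The map is given on the algebraic tensor product
  \<open>L\<^sup>p(M) \<otimes> X\<close>, which is dense in \<open>L\<^sup>p(M, X)\<close> since \<open>p < \<infinity>\<close>; it extends to a bounded operator on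
  \<open>L\<^sup>p(M, X)\<close> iff it is bounded on this subspace, and the extension has the same norm.
\<close>

definition tensor_Id_opnorm ::
  "real \<Rightarrow> 'a measure \<Rightarrow> 'b measure \<Rightarrow> (('a \<Rightarrow> complex) \<Rightarrow> 'b \<Rightarrow> complex) \<Rightarrow>
   (nat \<Rightarrow> complex) set \<Rightarrow> ((nat \<Rightarrow> complex) \<Rightarrow> real) \<Rightarrow> ennreal" where
  "tensor_Id_opnorm p M N T V \<nu> =
     Inf {C. \<forall>n f x. (\<forall>i<n. f i \<in> Lp p M \<and> x i \<in> V) \<longrightarrow>
            ennreal (Bochner_norm p N \<nu> (tensor_sum n (\<lambda>i. T (f i)) x))
              \<le> C * ennreal (Bochner_norm p M \<nu> (tensor_sum n f x))}"

definition regular_operator ::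
  "real \<Rightarrow> 'a measure \<Rightarrow> 'b measure \<Rightarrow> (('a \<Rightarrow> complex) \<Rightarrow> 'b \<Rightarrow> complex) \<Rightarrow> bool" where
  "regular_operator p M N T \<longleftrightarrow>
     Lp_linear p M N T \<and>
     (SUP (V, \<nu>) \<in> {(V, \<nu>). complex_banach V \<nu>}. tensor_Id_opnorm p M N T V \<nu>) < \<infinity>"

section \<open>Absolute value\<close>

text \<open>
  \<open>A\<close> represents \<open>|T|\<close>: it is a bounded positive operator and, for each positive \<open>f\<close>, \<open>A f\<close> is the
  least upper bound in the ordered space \<open>L\<^sup>p(N)\<close> of the functions \<open>|T g|\<close> with \<open>|g| \<le> f\<close>
  (not the pointwise supremum of representatives).
\<close>

definition is_modulus ::
  "real \<Rightarrow> 'a measure \<Rightarrow> 'b measure \<Rightarrow> (('a \<Rightarrow> complex) \<Rightarrow> 'b \<Rightarrow> complex) \<Rightarrow>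
   (('a \<Rightarrow> complex) \<Rightarrow> 'b \<Rightarrow> complex) \<Rightarrow> bool" where
  "is_modulus p M N T A \<longleftrightarrow>
     Lp_linear p M N A \<and> Lp_opnorm p M N A < \<infinity> \<and> Lp_positive p M N A \<and>
     (\<forall>f\<in>Lp p M. (AE x in M. 0 \<le> f x) \<longrightarrow>
        (\<forall>g\<in>Lp p M. (AE x in M. of_real (norm (g x)) \<le> f x) \<longrightarrow>
           (AE y in N. of_real (norm (T g y)) \<le> A f y)) \<and>
        (\<forall>h\<in>Lp p N.
           (\<forall>g\<in>Lp p M. (AE x in M. of_real (norm (g x)) \<le> f x) \<longrightarrow>
              (AE y in N. of_real (norm (T g y)) \<le> h y)) \<longrightarrow>
           (AE y in N. A f y \<le> h y)))"

section \<open>Complete positivity and the decomposable norm\<close>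

text \<open>
  An element of \<open>S\<^sup>p\<^sub>n(L\<^sup>p(M)) = L\<^sup>p(M, S\<^sup>p\<^sub>n)\<close> is a matrix of functions in \<open>L\<^sup>p(M)\<close> (all norms on
  \<open>n \<times> n\<close> matrices being equivalent); it is positive iff the matrix is positive semidefinite
  almost everywhere.  Rows and columns are indexed by an arbitrary finite set \<open>I\<close>, so that
  \<open>M\<^sub>n(S\<^sup>p\<^sub>k(L\<^sup>p(M))) = S\<^sup>p\<^sub>n\<^sub>k(L\<^sup>p(M))\<close> is the case \<open>I = {..<n} \<times> {..<k}\<close>.
\<close>

definition psd_on :: "'i set \<Rightarrow> ('i \<Rightarrow> 'i \<Rightarrow> complex) \<Rightarrow> bool" where
  "psd_on I A \<longleftrightarrow> (\<forall>v. 0 \<le> (\<Sum>i\<in>I. \<Sum>j\<in>I. cnj (v i) * A i j * v j))"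

definition Sp_cone :: "real \<Rightarrow> 'a measure \<Rightarrow> 'i set \<Rightarrow> ('i \<Rightarrow> 'i \<Rightarrow> 'a \<Rightarrow> complex) set" where
  "Sp_cone p M I =
     {F. (\<forall>i\<in>I. \<forall>j\<in>I. F i j \<in> Lp p M) \<and> (AE x in M. psd_on I (\<lambda>i j. F i j x))}"

text \<open>The map \<open>Id \<otimes> \<Phi>\<close>, which applies \<open>\<Phi>\<close> to every block \<open>F\<^sub>r\<^sub>s\<close> of a block matrix \<open>F\<close>:\<close>

definition amplification ::
  "((nat \<Rightarrow> nat \<Rightarrow> 'a \<Rightarrow> complex) \<Rightarrow> nat \<Rightarrow> nat \<Rightarrow> 'b \<Rightarrow> complex) \<Rightarrow>
   (nat \<times> nat \<Rightarrow> nat \<times> nat \<Rightarrow> 'a \<Rightarrow> complex) \<Rightarrow> nat \<times> nat \<Rightarrow> nat \<times> nat \<Rightarrow> 'b \<Rightarrow> complex" where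
  "amplification \<Phi> F = (\<lambda>(r, i) (s, j). \<Phi> (\<lambda>i' j'. F (r, i') (s, j')) i j)"

text \<open>For maps \<open>\<Phi> : S\<^sup>p\<^sub>k(L\<^sup>p(M)) \<rightarrow> S\<^sup>p\<^sub>k(L\<^sup>p(N))\<close>:\<close>

definition completely_positive ::
  "real \<Rightarrow> 'a measure \<Rightarrow> 'b measure \<Rightarrow> nat \<Rightarrow>
   ((nat \<Rightarrow> nat \<Rightarrow> 'a \<Rightarrow> complex) \<Rightarrow> nat \<Rightarrow> nat \<Rightarrow> 'b \<Rightarrow> complex) \<Rightarrow> bool" where
  "completely_positive p M N k \<Phi> \<longleftrightarrow>
     (\<forall>n\<ge>1. \<forall>F\<in>Sp_cone p M ({..<n} \<times> {..<k}).
        amplification \<Phi> F \<in> Sp_cone p N ({..<n} \<times> {..<k}))"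

definition conj_map ::
  "(('a \<Rightarrow> complex) \<Rightarrow> 'b \<Rightarrow> complex) \<Rightarrow> ('a \<Rightarrow> complex) \<Rightarrow> 'b \<Rightarrow> complex" where
  "conj_map T f = (\<lambda>y. cnj (T (\<lambda>x. cnj (f x)) y))"

text \<open>\<open>block_map a b c d\<close> is the entrywise map with matrix \<open>[[a, b], [c, d]]\<close>.\<close>

definition block_map ::
  "(('a \<Rightarrow> complex) \<Rightarrow> 'b \<Rightarrow> complex) \<Rightarrow> (('a \<Rightarrow> complex) \<Rightarrow> 'b \<Rightarrow> complex) \<Rightarrow>
   (('a \<Rightarrow> complex) \<Rightarrow> 'b \<Rightarrow> complex) \<Rightarrow> (('a \<Rightarrow> complex) \<Rightarrow> 'b \<Rightarrow> complex) \<Rightarrow>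
   (nat \<Rightarrow> nat \<Rightarrow> 'a \<Rightarrow> complex) \<Rightarrow> nat \<Rightarrow> nat \<Rightarrow> 'b \<Rightarrow> complex" where
  "block_map a b c d F = (\<lambda>i j.
     if i = 0 then (if j = 0 then a (F 0 0) else b (F 0 1))
     else (if j = 0 then c (F 1 0) else d (F 1 1)))"

definition dec_pairs ::
  "real \<Rightarrow> 'a measure \<Rightarrow> 'b measure \<Rightarrow> (('a \<Rightarrow> complex) \<Rightarrow> 'b \<Rightarrow> complex) \<Rightarrow>
   ((('a \<Rightarrow> complex) \<Rightarrow> 'b \<Rightarrow> complex) \<times> (('a \<Rightarrow> complex) \<Rightarrow> 'b \<Rightarrow> complex)) set" where
  "dec_pairs p M N T =
     {(v1, v2). Lp_linear p M N v1 \<and> Lp_linear p M N v2 \<and>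
        completely_positive p M N 2 (block_map v1 T (conj_map T) v2)}"

definition dec_norm ::
  "real \<Rightarrow> 'a measure \<Rightarrow> 'b measure \<Rightarrow> (('a \<Rightarrow> complex) \<Rightarrow> 'b \<Rightarrow> complex) \<Rightarrow> ennreal" where
  "dec_norm p M N T =
     (INF (v1, v2) \<in> dec_pairs p M N T. max (Lp_opnorm p M N v1) (Lp_opnorm p M N v2))"

end

theory Submission
  imports Defs
begin

text \<open>
  Complete positivity of \<open>[[|T|, T], [T\<^sup>\<circ>, |T|]]\<close> reduces to scalars.  A matrix in the amplified
  range is positive semidefinite almost everywhere as soon as its quadratic form is, for each
  constant vector, nonnegative almost everywhere, because countably many vectors are dense
  (\<open>AE_psd_onI\<close>).  For a constant vector with halves \<open>a\<close> and \<open>b\<close>, linearity turns the quadratic form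
  of the image into \<open>|T|(P) + |T|(S) + T(R) + cnj (T(R))\<close>, where \<open>P, R, S\<close> are the partial quadratic
  forms of the original matrix.  Positivity of that matrix at \<open>(w a, b)\<close> for all \<open>w\<close> on the unit circle
  gives \<open>2 |R| \<le> P + S\<close> (\<open>hermitian_from_rotations\<close>), hence \<open>2 |T(R)| \<le> |T|(P + S)\<close> by the
  definition of the modulus.

  Minimality of \<open>max \<parallel>|T|\<parallel> \<parallel>|T|\<parallel>\<close> comes from testing an admissible pair \<open>(v1, v2)\<close> on \<open>[[f, g], [cnj g, f]]\<close>
  with \<open>|g| \<le> f\<close>: it gives \<open>|T g| \<le> (v1 f + v2 f) / 2\<close> (\<open>dec_pair_bound\<close>), so \<open>|T| f\<close> is below the same
  average, and convexity of \<open>t \<mapsto> t powr p\<close> compares the norms.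

  Existence of the modulus rests on the \<open>p\<close>-integrability of finite maxima.  Regularity, applied to
  the spaces \<open>\<complex>\<^sup>n\<close> with the maximum norm, bounds \<open>max |T g\<^sub>i|\<close> in \<open>L\<^sup>p\<close> uniformly over all finite
  families with \<open>|g\<^sub>i| \<le> u\<close> (\<open>regular_maximal_bound\<close>).  An exhaustion argument then produces the least
  upper bound \<open>B u\<close> of the functions \<open>|T g|\<close>, \<open>|g| \<le> u\<close>, as a countable supremum
  (\<open>countable_essential_supremum\<close>, \<open>modulus_value_exists\<close>).  On the positive cone \<open>B\<close> is additive and
  positively homogeneous, so it extends to a bounded positive operator, which is the modulus.
\<close>

section \<open>Functions in \<open>L\<^sup>p\<close> and linear maps between them\<close>

lemma Lp_I [intro]:
  assumes "f \<in> borel_measurable M" "integrable M (\<lambda>x. norm (f x) powr p)"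
  shows "f \<in> Lp p M"
  using assms by (simp add: Lp_def)

lemma Lp_measurable [measurable_dest]: "f \<in> Lp p M \<Longrightarrow> f \<in> borel_measurable M"
  by (simp add: Lp_def)

lemma Lp_integrable: "f \<in> Lp p M \<Longrightarrow> integrable M (\<lambda>x. norm (f x) powr p)"
  by (simp add: Lp_def)

lemma Lp_dominated:
  assumes p: "0 \<le> p" and f: "f \<in> borel_measurable M" and g: "g \<in> Lp p M"
    and le: "AE x in M. norm (f x) \<le> norm (g x)"
  shows "f \<in> Lp p M"
proof
  show "integrable M (\<lambda>x. norm (f x) powr p)"
  proof (rule Bochner_Integration.integrable_bound[OF Lp_integrable[OF g]])
    show "AE x in M. norm (norm (f x) powr p) \<le> norm (norm (g x) powr p)"
      using le by eventually_elim (simp add: p powr_mono2)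
  qed (use f in measurable)
qed (fact f)

lemma Lp_cmult:
  assumes "f \<in> Lp p M" shows "(\<lambda>x. c * f x) \<in> Lp p M"
proof
  show "(\<lambda>x. c * f x) \<in> borel_measurable M"
    using Lp_measurable[OF assms] by measurable
  show "integrable M (\<lambda>x. norm (c * f x) powr p)"
    using Lp_integrable[OF assms] by (simp add: norm_mult powr_mult)
qed

lemma Lp_norm_fun:
  assumes "f \<in> Lp p M" shows "(\<lambda>x. complex_of_real (norm (f x))) \<in> Lp p M"
proof
  show "(\<lambda>x. complex_of_real (norm (f x))) \<in> borel_measurable M"
    using Lp_measurable[OF assms] by measurable
qed (use Lp_integrable[OF assms] in simp)

lemma Lp_add:
  assumes p: "0 \<le> p" and f: "f \<in> Lp p M" and g: "g \<in> Lp p M"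
  shows "(\<lambda>x. f x + g x) \<in> Lp p M"
proof
  note [measurable] = Lp_measurable[OF f] Lp_measurable[OF g]
  show "(\<lambda>x. f x + g x) \<in> borel_measurable M" by measurable
  show "integrable M (\<lambda>x. norm (f x + g x) powr p)"
  proof (rule Bochner_Integration.integrable_bound)
    show "integrable M (\<lambda>x. 2 powr p * (norm (f x) powr p + norm (g x) powr p))"
      using Lp_integrable[OF f] Lp_integrable[OF g] by simp
    have "norm (f x + g x) powr p \<le> 2 powr p * (norm (f x) powr p + norm (g x) powr p)" for x
    proof -
      have "norm (f x + g x) \<le> 2 * max (norm (f x)) (norm (g x))"
        using norm_triangle_ineq[of "f x" "g x"] by linarith
      hence "norm (f x + g x) powr p \<le> (2 * max (norm (f x)) (norm (g x))) powr p"
        using p by (simp add: powr_mono2)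
      also have "\<dots> = 2 powr p * max (norm (f x)) (norm (g x)) powr p"
        by (simp add: powr_mult)
      also have "\<dots> \<le> 2 powr p * (norm (f x) powr p + norm (g x) powr p)"
        by (intro mult_left_mono) (auto simp: max_def)
      finally show ?thesis .
    qed
    thus "AE x in M. norm (norm (f x + g x) powr p)
            \<le> norm (2 powr p * (norm (f x) powr p + norm (g x) powr p))"
      by auto
  qed measurable
qed

lemma Lp_cnj:
  assumes "f \<in> Lp p M" shows "(\<lambda>x. cnj (f x)) \<in> Lp p M"
proof
  show "(\<lambda>x. cnj (f x)) \<in> borel_measurable M"
    using Lp_measurable[OF assms]
    by (rule borel_measurable_continuous_onI[OF continuous_on_cnj[OF continuous_on_id], THEN measurable_compose_rev])
qed (use Lp_integrable[OF assms] in simp)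

lemma Lp_Re:
  assumes p: "0 \<le> p" and f: "f \<in> Lp p M"
  shows "(\<lambda>x. complex_of_real (Re (f x))) \<in> Lp p M"
proof (rule Lp_dominated[OF p _ f])
  show "(\<lambda>x. complex_of_real (Re (f x))) \<in> borel_measurable M"
    using Lp_measurable[OF f] by measurable
qed (simp add: abs_Re_le_cmod)

lemma Lp_Im:
  assumes p: "0 \<le> p" and f: "f \<in> Lp p M"
  shows "(\<lambda>x. complex_of_real (Im (f x))) \<in> Lp p M"
proof (rule Lp_dominated[OF p _ f])
  show "(\<lambda>x. complex_of_real (Im (f x))) \<in> borel_measurable M"
    using Lp_measurable[OF f] by measurable
qed (simp add: abs_Im_le_cmod)

lemma Lp_zero: "(\<lambda>_. 0) \<in> Lp p M"
  by (rule Lp_I) auto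

lemma Lp_sum:
  assumes "0 \<le> p" "\<And>i. i \<in> I \<Longrightarrow> f i \<in> Lp p M"
  shows "(\<lambda>x. \<Sum>i\<in>I. f i x) \<in> Lp p M"
  using assms(2)
  by (induction I rule: infinite_finite_induct) (simp_all add: Lp_zero Lp_add[OF assms(1)])

lemma Lp_linearD:
  assumes "Lp_linear p M N T"
  shows Lp_linear_in: "f \<in> Lp p M \<Longrightarrow> T f \<in> Lp p N"
    and Lp_linear_cong: "f \<in> Lp p M \<Longrightarrow> g \<in> Lp p M \<Longrightarrow> AE x in M. f x = g x \<Longrightarrow> AE y in N. T f y = T g y"
    and Lp_linear_add: "f \<in> Lp p M \<Longrightarrow> g \<in> Lp p M \<Longrightarrow> AE y in N. T (\<lambda>x. f x + g x) y = T f y + T g y"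
    and Lp_linear_cmult: "f \<in> Lp p M \<Longrightarrow> AE y in N. T (\<lambda>x. c * f x) y = c * T f y"
  using assms unfolding Lp_linear_def by blast+

lemma Lp_linear_zero:
  assumes T: "Lp_linear p M N T"
  shows "AE y in N. T (\<lambda>_. 0) y = 0"
  using Lp_linear_cmult[OF T Lp_zero, of 0] by simp

lemma Lp_linear_sum:
  assumes p: "0 \<le> p" and T: "Lp_linear p M N T"
    and fin: "finite I" and f: "\<And>i. i \<in> I \<Longrightarrow> f i \<in> Lp p M"
  shows "AE y in N. T (\<lambda>x. \<Sum>i\<in>I. c i * f i x) y = (\<Sum>i\<in>I. c i * T (f i) y)"
  using fin f
proof (induction I)
  case empty
  then show ?case using Lp_linear_zero[OF T] by simp
next
  case (insert i I)
  have 1: "(\<lambda>x. c i * f i x) \<in> Lp p M" using insert by (intro Lp_cmult) auto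
  have 2: "(\<lambda>x. \<Sum>i\<in>I. c i * f i x) \<in> Lp p M"
    using insert by (intro Lp_sum[OF p] Lp_cmult) auto
  have 3: "AE y in N. T (\<lambda>x. c i * f i x) y = c i * T (f i) y"
    using insert by (intro Lp_linear_cmult[OF T]) auto
  have 4: "AE y in N. T (\<lambda>x. \<Sum>i\<in>I. c i * f i x) y = (\<Sum>i\<in>I. c i * T (f i) y)"
    using insert by auto
  show ?case
    using Lp_linear_add[OF T 1 2] 3 4
    by eventually_elim (simp add: insert.hyps)
qed

section \<open>Complex inequalities from rotations\<close>

lemma complex_nonneg_iff: "(0::complex) \<le> z \<longleftrightarrow> 0 \<le> Re z \<and> Im z = 0"
  by (auto simp: less_eq_complex_def)

lemma of_real_le_complex_iff: "complex_of_real r \<le> z \<longleftrightarrow> r \<le> Re z \<and> Im z = 0"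
  by (auto simp: less_eq_complex_def)

text \<open>
  Almost everywhere statements can only be combined over countable index sets.  Suprema over the
  unit circle are therefore taken over rational angles.
\<close>

lemma le_from_rationals:
  fixes f :: "real \<Rightarrow> real"
  assumes "continuous_on UNIV f" "\<And>q. q \<in> \<rat> \<Longrightarrow> f q \<le> w"
  shows "f t \<le> w"
  using continuous_le_on_closure[of "\<rat>" f t w] assms
  by (auto simp: Rats_closure_real)

lemma norm_le_from_rotations:
  assumes "\<And>q. q \<in> \<rat> \<Longrightarrow> Re (cis q * z) \<le> w"
  shows "norm z \<le> w"
proof -
  have "Re (cis (- Arg z) * z) \<le> w"
    by (rule le_from_rationals[where f = "\<lambda>t. Re (cis t * z)"], intro continuous_intros)
       (rule assms)
  moreover have "cis (- Arg z) * z = of_real (norm z)"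
    by (metis cis_mult cis_zero mult.commute mult.left_commute mult.right_neutral rcis_cmod_Arg
        rcis_def add.right_inverse)
  ultimately show ?thesis by simp
qed

lemma sum_norms_le_from_rotations:
  assumes "\<And>q. q \<in> \<rat> \<Longrightarrow> norm (a + cis q * b) \<le> w"
  shows "norm a + norm b \<le> w"
proof -
  let ?t = "Arg a - Arg b"
  have "norm (a + cis ?t * b) \<le> w"
    by (rule le_from_rationals[where f = "\<lambda>t. norm (a + cis t * b)"], intro continuous_intros)
       (rule assms)
  moreover have "a + cis ?t * b = of_real (norm a + norm b) * cis (Arg a)"
  proof -
    have "cis ?t * (of_real (norm b) * cis (Arg b)) = of_real (norm b) * cis (Arg a)"
      using cis_mult[of ?t "Arg b"] by (simp add: mult.commute mult.left_commute)
    moreover have "of_real (norm b) * cis (Arg b) = b" "of_real (norm a) * cis (Arg a) = a"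
      by (metis rcis_cmod_Arg rcis_def)+
    ultimately show ?thesis by (metis distrib_right of_real_add)
  qed
  ultimately show ?thesis by (simp only: norm_mult norm_of_real norm_cis) simp
qed

text \<open>
  The expression is the quadratic form of a \<open>2 \<times> 2\<close> block matrix at the vector \<open>(w, 1)\<close>, with \<open>X\<close> the
  sum of the diagonal contributions.  The four values \<open>w = 1, -1, \<i>, -\<i>\<close> force the off-diagonal terms
  to be conjugate, and the value with \<open>cnj w * R = - norm R\<close> gives the estimate.  Since \<open>w\<close> ranges
  over the unit circle only, the bound involves the arithmetic rather than the geometric mean.
\<close>

lemma hermitian_from_rotations:
  assumes "\<And>w. norm w = 1 \<Longrightarrow> 0 \<le> X + cnj w * R + w * R'"
  shows "R' = cnj R" and "of_real (2 * norm R) \<le> X"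
proof -
  have *: "0 \<le> Re (X + cnj w * R + w * R') \<and> Im (X + cnj w * R + w * R') = 0" if "norm w = 1" for w
    using assms[OF that] by (simp only: complex_nonneg_iff)
  have X: "Im X = 0" and R': "R' = cnj R"
    using *[of 1] *[of "-1"] *[of \<i>] *[of "-\<i>"] by (auto simp: complex_eq_iff)
  show "R' = cnj R" by fact
  show "of_real (2 * norm R) \<le> X"
  proof (cases "R = 0")
    case True
    then show ?thesis using *[of 1] X R' by (simp add: complex_nonneg_iff)
  next
    case False
    let ?w = "- sgn R"
    have "cnj (sgn R) * R = of_real (norm R)"
      using False
      by (simp add: sgn_eq complex_norm_square[symmetric] power2_eq_square mult.commute)
    moreover from this have "sgn R * cnj R = of_real (norm R)"
      by (metis complex_cnj_cnj complex_cnj_complex_of_real complex_cnj_mult)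
    ultimately have "0 \<le> Re (X + - of_real (norm R) + - of_real (norm R))"
      using *[of ?w] False unfolding R' by (simp add: norm_sgn)
    then show ?thesis using X by (simp add: less_eq_complex_def)
  qed
qed

section \<open>Complete positivity of the block map of a modulus\<close>

text \<open>
  The exceptional null set in the hypothesis depends on \<open>v\<close>.  It is made uniform by taking \<open>v\<close> from
  a countable dense set of vectors and passing to the limit in the quadratic form.
\<close>

lemma AE_psd_onI:
  assumes fin: "finite I"
    and form: "\<And>v. AE y in N. 0 \<le> (\<Sum>i\<in>I. \<Sum>j\<in>I. cnj (v i) * G i j y * v j)"
  shows "AE y in N. psd_on I (\<lambda>i j. G i j y)"
proof -
  obtain D :: "complex set" where D: "countable D"
    and dense: "\<And>X. open X \<Longrightarrow> X \<noteq> {} \<Longrightarrow> \<exists>d\<in>D. d \<in> X"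
    by (rule countable_dense_setE) blast
  have "countable (PiE I (\<lambda>_. D))"
    using fin D by (intro countable_PiE) auto
  with form have "AE y in N. \<forall>v\<in>PiE I (\<lambda>_. D).
      0 \<le> (\<Sum>i\<in>I. \<Sum>j\<in>I. cnj (v i) * G i j y * v j)"
    by (simp add: AE_ball_countable)
  then show ?thesis
  proof eventually_elim
    case (elim y)
    show ?case unfolding psd_on_def
    proof
      fix v :: "'a \<Rightarrow> complex"
      have "\<exists>d\<in>D. dist d (v i) < 1 / real (Suc k)" for i k
        using dense[of "ball (v i) (1 / real (Suc k))"] by (auto simp: dist_commute)
      then obtain d where d: "\<And>i k. d i k \<in> D" "\<And>i k. dist (d i k) (v i) < 1 / real (Suc k)"
        by metis
      have lim: "(\<lambda>k. d i k) \<longlonglongrightarrow> v i" for i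
      proof (rule metric_LIMSEQ_I)
        fix e :: real assume "e > 0"
        then obtain k0 where k0: "1 / real (Suc k0) < e"
          using nat_approx_posE by blast
        have "dist (d i k) (v i) < e" if "k \<ge> k0" for k
        proof -
          have "1 / real (Suc k) \<le> 1 / real (Suc k0)" using that by (simp add: frac_le)
          with d(2)[of i k] k0 show ?thesis by linarith
        qed
        then show "\<exists>no. \<forall>n\<ge>no. dist (d i n) (v i) < e" by blast
      qed
      let ?q = "\<lambda>v. \<Sum>i\<in>I. \<Sum>j\<in>I. cnj (v i) * G i j y * v j"
      have q: "(\<lambda>k. ?q (\<lambda>i. d i k)) \<longlonglongrightarrow> ?q v"
        by (intro tendsto_intros lim)
      have "0 \<le> ?q (\<lambda>i. d i k)" for k
      proof -
        have "restrict (\<lambda>i. d i k) I \<in> PiE I (\<lambda>_. D)" using d by auto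
        with elim have "0 \<le> ?q (restrict (\<lambda>i. d i k) I)" by blast
        also have "?q (restrict (\<lambda>i. d i k) I) = ?q (\<lambda>i. d i k)"
          by (intro sum.cong) auto
        finally show ?thesis .
      qed
      then have *: "0 \<le> Re (?q (\<lambda>i. d i k))" "Im (?q (\<lambda>i. d i k)) = 0" for k
        unfolding complex_nonneg_iff by blast+
      have "0 \<le> Re (?q v)"
        by (rule LIMSEQ_le_const[OF tendsto_Re[OF q]]) (use * in blast)
      moreover have "Im (?q v) = 0"
        using LIMSEQ_unique[OF tendsto_Im[OF q, unfolded *(2)] tendsto_const] .
      ultimately show "0 \<le> ?q v" unfolding complex_nonneg_iff by blast
    qed
  qed
qed

lemma Lp_linear_conj_map:
  assumes T: "Lp_linear p M N T"
  shows "Lp_linear p M N (conj_map T)"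
  unfolding Lp_linear_def
proof (intro conjI ballI allI impI)
  fix f assume "f \<in> Lp p M"
  then show "conj_map T f \<in> Lp p N"
    unfolding conj_map_def by (intro Lp_cnj Lp_linear_in[OF T])
next
  fix f g assume fg: "f \<in> Lp p M" "g \<in> Lp p M" and "AE x in M. f x = g x"
  then have "AE x in M. cnj (f x) = cnj (g x)" by auto
  from Lp_linear_cong[OF T Lp_cnj Lp_cnj this] fg
  show "AE y in N. conj_map T f y = conj_map T g y"
    unfolding conj_map_def by auto
next
  fix f g assume fg: "f \<in> Lp p M" "g \<in> Lp p M"
  from Lp_linear_add[OF T Lp_cnj[OF fg(1)] Lp_cnj[OF fg(2)]]
  show "AE y in N. conj_map T (\<lambda>x. f x + g x) y = conj_map T f y + conj_map T g y"
    unfolding conj_map_def by (auto elim!: eventually_mono)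
next
  fix c f assume f: "f \<in> Lp p M"
  from Lp_linear_cmult[OF T Lp_cnj[OF f], of "cnj c"]
  show "AE y in N. conj_map T (\<lambda>x. c * f x) y = c * conj_map T f y"
    unfolding conj_map_def by (auto elim!: eventually_mono)
qed

lemma is_modulusD:
  assumes "is_modulus p M N T A"
  shows is_modulus_linear: "Lp_linear p M N A"
    and is_modulus_positive: "Lp_positive p M N A"
    and is_modulus_upper:
      "f \<in> Lp p M \<Longrightarrow> g \<in> Lp p M \<Longrightarrow> AE x in M. of_real (norm (g x)) \<le> f x \<Longrightarrow>
       AE y in N. of_real (norm (T g y)) \<le> A f y"
    and is_modulus_least:
      "f \<in> Lp p M \<Longrightarrow> AE x in M. 0 \<le> f x \<Longrightarrow> h \<in> Lp p N \<Longrightarrow>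
       (\<And>g. g \<in> Lp p M \<Longrightarrow> AE x in M. of_real (norm (g x)) \<le> f x \<Longrightarrow>
         AE y in N. of_real (norm (T g y)) \<le> h y) \<Longrightarrow>
       AE y in N. A f y \<le> h y"
proof -
  show "Lp_linear p M N A" "Lp_positive p M N A"
    using assms by (auto simp: is_modulus_def)
  show "AE y in N. of_real (norm (T g y)) \<le> A f y"
    if f: "f \<in> Lp p M" and g: "g \<in> Lp p M" "AE x in M. of_real (norm (g x)) \<le> f x"
  proof -
    from g(2) have "AE x in M. 0 \<le> f x"
      by eventually_elim (auto simp: less_eq_complex_def intro: order_trans[OF norm_ge_zero])
    with assms f g show ?thesis by (simp add: is_modulus_def)
  qed
  show "AE y in N. A f y \<le> h y"
    if "f \<in> Lp p M" "AE x in M. 0 \<le> f x" "h \<in> Lp p N"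
       "\<And>g. g \<in> Lp p M \<Longrightarrow> AE x in M. of_real (norm (g x)) \<le> f x \<Longrightarrow>
         AE y in N. of_real (norm (T g y)) \<le> h y"
    using assms that by (simp add: is_modulus_def)
qed

lemma sum_times_2: "(\<Sum>i\<in>{..<n::nat} \<times> {..<2::nat}. g i) = (\<Sum>r<n. g (r, 0) + g (r, 1))"
proof -
  have "{..<2::nat} = {0, 1}" by auto
  then show ?thesis by (simp add: sum.cartesian_product')
qed

text \<open>
  Everything is collapsed to four scalar functions: for a fixed vector \<open>v\<close>, the block \<open>(k, l)\<close> of
  \<open>F\<close> contributes \<open>Q k l\<close>, and the quadratic form of the image is
  \<open>A (Q 0 0) + T (Q 0 1) + conj_map T (Q 1 0) + A (Q 1 1)\<close>.
\<close>

lemma completely_positive_modulus: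
  assumes p: "0 \<le> p" and T: "Lp_linear p M N T" and A: "is_modulus p M N T A"
  shows "completely_positive p M N 2 (block_map A T (conj_map T) A)"
  unfolding completely_positive_def
proof (intro allI impI ballI)
  fix n :: nat and F
  let ?I = "{..<n} \<times> {..<2::nat}"
  let ?\<Phi> = "block_map A T (conj_map T) A"
  assume "F \<in> Sp_cone p M ?I"
  then have F: "\<And>i j. i \<in> ?I \<Longrightarrow> j \<in> ?I \<Longrightarrow> F i j \<in> Lp p M"
    and psd: "AE x in M. psd_on ?I (\<lambda>i j. F i j x)"
    by (auto simp: Sp_cone_def)
  note lA = is_modulus_linear[OF A] and lT' = Lp_linear_conj_map[OF T]
  have G: "amplification ?\<Phi> F i j \<in> Lp p N" if "i \<in> ?I" "j \<in> ?I" for i j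
    using that
    by (auto simp: amplification_def block_map_def
        intro!: Lp_linear_in[OF lA] Lp_linear_in[OF T] Lp_linear_in[OF lT'] F)
  have "AE y in N. 0 \<le> (\<Sum>i\<in>?I. \<Sum>j\<in>?I. cnj (v i) * amplification ?\<Phi> F i j y * v j)" for v
  proof -
    define J where "J = {..<n} \<times> {..<n}"
    define c where "c k l rs = cnj (v (fst rs, k)) * v (snd rs, l)" for k l and rs :: "nat \<times> nat"
    define E where "E k l rs = F (fst rs, k) (snd rs, l)" for k l and rs :: "nat \<times> nat"
    define Q where "Q k l x = (\<Sum>rs\<in>J. c k l rs * E k l rs x)" for k l x
    have E: "E k l rs \<in> Lp p M" if "rs \<in> J" "k < 2" "l < 2" for k l rs
      using that by (auto simp: E_def J_def intro!: F)
    have Q: "Q k l \<in> Lp p M" if "k < 2" "l < 2" for k l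
      unfolding Q_def using that by (intro Lp_sum[OF p] Lp_cmult E)
    have Q_image: "AE y in N. L (Q k l) y = (\<Sum>rs\<in>J. c k l rs * L (E k l rs) y)"
      if "Lp_linear p M N L" "k < 2" "l < 2" for L k l
      unfolding Q_def using that E by (intro Lp_linear_sum[OF p]) (auto simp: J_def)
    have "AE x in M. Q 1 0 x = cnj (Q 0 1 x) \<and> of_real (2 * norm (Q 0 1 x)) \<le> Q 0 0 x + Q 1 1 x"
      using psd
    proof eventually_elim
      case (elim x)
      have "0 \<le> (Q 0 0 x + Q 1 1 x) + cnj w * Q 0 1 x + w * Q 1 0 x" if w: "norm w = 1" for w
      proof -
        \<comment> \<open>rotating the first half of \<open>v\<close> by \<open>w\<close> leaves the diagonal contributions unchanged\<close>
        define u where "u i = (if snd i = 0 then w else 1) * v i" for i :: "nat \<times> nat"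
        have w': "cnj w * w = 1" "w * cnj w = 1"
          using w complex_norm_square[of w] by (simp_all add: mult.commute)
        have "0 \<le> (\<Sum>i\<in>?I. \<Sum>j\<in>?I. cnj (u i) * F i j x * u j)"
          using elim by (simp add: psd_on_def)
        also have "\<dots> = (Q 0 0 x + Q 1 1 x) + cnj w * Q 0 1 x + w * Q 1 0 x"
        proof -
          have w_cancel: "w * (cnj w * z) = z" for z
            using w'(2) by (simp flip: mult.assoc)
          show ?thesis
            unfolding Q_def J_def c_def E_def u_def sum_times_2
            by (simp add: sum.cartesian_product' sum.distrib sum_distrib_left algebra_simps w_cancel)
        qed
        finally show ?thesis .
      qed
      from hermitian_from_rotations[OF this] show ?case by blast
    qed
    then have Q_herm: "AE x in M. cnj (Q 1 0 x) = Q 0 1 x"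
      and Q_le: "AE x in M. of_real (norm (2 * Q 0 1 x)) \<le> Q 0 0 x + Q 1 1 x"
      by (auto simp: norm_mult elim!: eventually_mono)
    have S: "(\<lambda>x. Q 0 0 x + Q 1 1 x) \<in> Lp p M" by (intro Lp_add[OF p] Q) auto
    \<comment> \<open>the defining upper bound of the modulus, applied to \<open>|2 Q 0 1| \<le> Q 0 0 + Q 1 1\<close>\<close>
    have dom: "AE y in N. of_real (norm (T (\<lambda>x. 2 * Q 0 1 x) y)) \<le> A (\<lambda>x. Q 0 0 x + Q 1 1 x) y"
      by (rule is_modulus_upper[OF A S _ Q_le]) (intro Lp_cmult Q, auto)
    have add: "AE y in N. A (\<lambda>x. Q 0 0 x + Q 1 1 x) y = A (Q 0 0) y + A (Q 1 1) y"
      by (intro Lp_linear_add[OF lA] Q) auto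
    have two: "AE y in N. T (\<lambda>x. 2 * Q 0 1 x) y = 2 * T (Q 0 1) y"
      by (intro Lp_linear_cmult[OF T] Q) auto
    have cj: "AE y in N. T (\<lambda>x. cnj (Q 1 0 x)) y = T (Q 0 1) y"
      by (intro Lp_linear_cong[OF T] Q Lp_cnj Q_herm) auto
    have Q00: "AE y in N. A (Q 0 0) y = (\<Sum>rs\<in>J. c 0 0 rs * A (E 0 0 rs) y)"
      and Q01: "AE y in N. T (Q 0 1) y = (\<Sum>rs\<in>J. c 0 1 rs * T (E 0 1 rs) y)"
      and Q10: "AE y in N. conj_map T (Q 1 0) y = (\<Sum>rs\<in>J. c 1 0 rs * conj_map T (E 1 0 rs) y)"
      and Q11: "AE y in N. A (Q 1 1) y = (\<Sum>rs\<in>J. c 1 1 rs * A (E 1 1 rs) y)"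
      by (intro Q_image lA T lT'; simp)+
    show ?thesis
      using dom add two cj Q00 Q01 Q10 Q11
    proof eventually_elim
      case (elim y)
      have "(\<Sum>i\<in>?I. \<Sum>j\<in>?I. cnj (v i) * amplification ?\<Phi> F i j y * v j) =
        A (Q 0 0) y + T (Q 0 1) y + conj_map T (Q 1 0) y + A (Q 1 1) y"
        unfolding elim J_def c_def E_def sum_times_2
        by (simp add: sum.cartesian_product' sum.distrib algebra_simps amplification_def block_map_def)
      also have "\<dots> = A (Q 0 0) y + A (Q 1 1) y + T (Q 0 1) y + cnj (T (Q 0 1) y)"
        using elim by (simp add: conj_map_def)
      finally have eq: "(\<Sum>i\<in>?I. \<Sum>j\<in>?I. cnj (v i) * amplification ?\<Phi> F i j y * v j) =
        A (Q 0 0) y + A (Q 1 1) y + T (Q 0 1) y + cnj (T (Q 0 1) y)" .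
      have "of_real (2 * norm (T (Q 0 1) y)) \<le> A (Q 0 0) y + A (Q 1 1) y"
        using elim(1) unfolding elim(2,3) by (simp add: norm_mult)
      then show ?case
        unfolding eq complex_nonneg_iff of_real_le_complex_iff
        using abs_Re_le_cmod[of "T (Q 0 1) y"] by (auto simp: abs_le_iff)
    qed
  qed
  then have "AE y in N. psd_on ?I (\<lambda>i j. amplification ?\<Phi> F i j y)"
    by (intro AE_psd_onI) auto
  with G show "amplification ?\<Phi> F \<in> Sp_cone p N ?I" by (simp add: Sp_cone_def)
qed

section \<open>Positive operators\<close>

lemma positive_linear_mono:
  assumes p: "0 \<le> p" and A: "Lp_linear p M N A" "Lp_positive p M N A"
    and f: "f \<in> Lp p M" and g: "g \<in> Lp p M" and le: "AE x in M. f x \<le> g x"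
  shows "AE y in N. A f y \<le> A g y"
proof -
  have m: "(\<lambda>x. -1 * f x) \<in> Lp p M" by (intro Lp_cmult f)
  have "AE x in M. 0 \<le> g x + -1 * f x"
    using le by eventually_elim (simp add: less_eq_complex_def)
  then have "AE y in N. 0 \<le> A (\<lambda>x. g x + -1 * f x) y"
    using A(2) Lp_add[OF p g m] by (simp add: Lp_positive_def)
  with Lp_linear_add[OF A(1) g m] Lp_linear_cmult[OF A(1) f, of "-1"]
  show ?thesis by eventually_elim (simp add: less_eq_complex_def)
qed

text \<open>
  A real function is the difference of the nonnegative functions \<open>|f|\<close> and \<open>|f| - f\<close>.
\<close>

lemma positive_linear_real:
  assumes p: "0 \<le> p" and A: "Lp_linear p M N A" "Lp_positive p M N A"
    and f: "f \<in> Lp p M" and re: "AE x in M. Im (f x) = 0"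
  shows "AE y in N. Im (A f y) = 0"
proof -
  let ?n = "\<lambda>x. complex_of_real (norm (f x))"
  have n: "?n \<in> Lp p M" by (rule Lp_norm_fun[OF f])
  have "AE y in N. 0 \<le> A ?n y"
    using A(2) n by (simp add: Lp_positive_def complex_nonneg_iff)
  moreover have "AE x in M. f x \<le> ?n x"
    using re by eventually_elim (simp add: less_eq_complex_def complex_Re_le_cmod)
  from positive_linear_mono[OF p A f n this] have "AE y in N. A f y \<le> A ?n y" .
  ultimately show ?thesis by eventually_elim (simp add: less_eq_complex_def)
qed

text \<open>
  The modulus of a complex number is the supremum of the real parts of its rotations, and
  \<open>Re (cis q * f) \<le> |f|\<close> is preserved by a positive operator for each of the countably many
  rational angles \<open>q\<close>.
\<close>

lemma positive_linear_norm_le: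
  assumes p: "0 \<le> p" and A: "Lp_linear p M N A" "Lp_positive p M N A" and f: "f \<in> Lp p M"
  shows "AE y in N. of_real (norm (A f y)) \<le> A (\<lambda>x. of_real (norm (f x))) y"
proof -
  let ?n = "\<lambda>x. complex_of_real (norm (f x))"
  have n: "?n \<in> Lp p M" by (rule Lp_norm_fun[OF f])
  have An: "AE y in N. 0 \<le> A ?n y"
    using A(2) n by (simp add: Lp_positive_def complex_nonneg_iff)
  have rot: "AE y in N. Re (cis q * A f y) \<le> Re (A ?n y)" for q
  proof -
    define R where "R x = complex_of_real (Re (cis q * f x))" for x
    define I where "I x = complex_of_real (Im (cis q * f x))" for x
    have R: "R \<in> Lp p M" and I: "I \<in> Lp p M"
      unfolding R_def I_def by (intro Lp_Re Lp_Im Lp_cmult f p)+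
    have "AE x in M. R x \<le> ?n x"
      using complex_Re_le_cmod[of "cis q * f x" for x]
      by (intro AE_I2) (simp add: R_def less_eq_complex_def norm_mult del: cis.sel)
    from positive_linear_mono[OF p A R n this] have 1: "AE y in N. A R y \<le> A ?n y" .
    have 2: "AE y in N. Im (A I y) = 0"
      by (rule positive_linear_real[OF p A I]) (simp add: I_def)
    have "(\<lambda>x. cis q * f x) = (\<lambda>x. R x + \<i> * I x)"
      by (simp add: fun_eq_iff R_def I_def complex_eq_iff)
    with Lp_linear_cmult[OF A(1) f, of "cis q"] Lp_linear_add[OF A(1) R Lp_cmult[OF I, of \<i>]]
      Lp_linear_cmult[OF A(1) I, of \<i>]
    have 3: "AE y in N. cis q * A f y = A R y + \<i> * A I y"
      by (auto elim!: eventually_elim2[rotated] AE_mp)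
    show ?thesis using 1 2 3 by eventually_elim (simp add: less_eq_complex_def del: cis.sel)
  qed
  have "AE y in N. \<forall>q\<in>\<rat>. Re (cis q * A f y) \<le> Re (A ?n y)"
    using rot by (simp add: AE_ball_countable countable_rat)
  with An show ?thesis
  proof eventually_elim
    case (elim y)
    then have "norm (A f y) \<le> Re (A ?n y)" by (intro norm_le_from_rotations) blast
    with elim(1) show ?case by (simp add: of_real_le_complex_iff complex_nonneg_iff)
  qed
qed

section \<open>The decomposable norm\<close>

lemma powr_midpoint_convex:
  fixes a b p :: real
  assumes p: "1 \<le> p" and ab: "0 \<le> a" "0 \<le> b"
  shows "((a + b) / 2) powr p \<le> (a powr p + b powr p) / 2"
proof -
  have half: "(t / 2) powr p \<le> t powr p / 2" if "0 \<le> t" for t :: real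
  proof -
    have "2 powr 1 \<le> (2::real) powr p" using p by (intro powr_mono) auto
    then have "t powr p / 2 powr p \<le> t powr p / 2" by (intro divide_left_mono) auto
    then show ?thesis using that by (simp add: powr_divide)
  qed
  show ?thesis
  proof (cases "a = 0 \<or> b = 0")
    case True
    then show ?thesis using half ab by auto
  next
    case False
    with ab have "a \<in> {0<..}" "b \<in> {0<..}" by auto
    from convex_onD[OF powr_convex[OF p], of "1/2", OF _ _ this]
    show ?thesis by (simp add: field_simps)
  qed
qed

lemma Lp_norm_le_iff:
  assumes p: "0 < p" and k: "0 \<le> k"
  shows "Lp_norm p M f \<le> k \<longleftrightarrow> (\<integral>x. norm (f x) powr p \<partial>M) \<le> k powr p"
proof -
  have I: "0 \<le> (\<integral>x. norm (f x) powr p \<partial>M)" by (intro integral_nonneg_AE) auto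
  have "Lp_norm p M f \<le> k \<longleftrightarrow> Lp_norm p M f powr p \<le> k powr p"
    using p k powr_mono2[of p "Lp_norm p M f" k] powr_less_mono2[of p k "Lp_norm p M f"]
    by (force simp: Lp_norm_def not_le[symmetric])
  also have "Lp_norm p M f powr p = (\<integral>x. norm (f x) powr p \<partial>M)"
    using p I by (simp add: Lp_norm_def powr_powr)
  finally show ?thesis .
qed

lemma Lp_norm_nonneg: "0 \<le> Lp_norm p M f"
  by (simp add: Lp_norm_def)

text \<open>
  The test matrix \<open>[[f, g], [cnj g, f]]\<close> is positive because \<open>|g| \<le> f\<close>.  Its image has off-diagonal
  entries \<open>T g\<close> and \<open>cnj (T g)\<close>.
\<close>

lemma dec_pair_bound:
  assumes p: "0 \<le> p" and pair: "(v1, v2) \<in> dec_pairs p M N T"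
    and f: "f \<in> Lp p M" and g: "g \<in> Lp p M" and le: "AE x in M. of_real (norm (g x)) \<le> f x"
  shows "AE y in N. 0 \<le> v1 f y \<and> 0 \<le> v2 f y \<and> of_real (2 * norm (T g y)) \<le> v1 f y + v2 f y"
proof -
  define F :: "nat \<times> nat \<Rightarrow> nat \<times> nat \<Rightarrow> 'a \<Rightarrow> complex" where
    "F i j = (if snd i = snd j then f else if snd i = 0 then g else (\<lambda>x. cnj (g x)))" for i j
  let ?\<Phi> = "block_map v1 T (conj_map T) v2"
  let ?I = "{..<1::nat} \<times> {..<2::nat}"
  have "F \<in> Sp_cone p M ?I"
    unfolding Sp_cone_def
  proof (intro CollectI conjI ballI)
    show "F i j \<in> Lp p M" for i j by (auto simp: F_def f g Lp_cnj)
    show "AE x in M. psd_on ?I (\<lambda>i j. F i j x)"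
      using le
    proof eventually_elim
      case (elim x)
      show ?case unfolding psd_on_def
      proof
        fix v :: "nat \<times> nat \<Rightarrow> complex"
        define a b where "a = v (0, 0)" and "b = v (0, 1)"
        obtain r where r: "f x = of_real r" "norm (g x) \<le> r"
          using elim by (auto simp: of_real_le_complex_iff complex_eq_iff intro!: that[of "Re (f x)"])
        have "(\<Sum>i\<in>?I. \<Sum>j\<in>?I. cnj (v i) * F i j x * v j) =
          of_real (r * ((norm a)\<^sup>2 + (norm b)\<^sup>2) + 2 * Re (cnj a * g x * b))"
          unfolding sum_times_2 a_def b_def
          by (simp add: F_def r(1) complex_eq_iff cmod_power2)
             (simp add: algebra_simps power2_eq_square)
        moreover have "0 \<le> r * ((norm a)\<^sup>2 + (norm b)\<^sup>2) + 2 * Re (cnj a * g x * b)"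
        proof -
          have "\<bar>Re (cnj a * g x * b)\<bar> \<le> norm a * norm (g x) * norm b"
            using abs_Re_le_cmod[of "cnj a * g x * b"] by (simp add: norm_mult)
          also have "\<dots> \<le> norm a * r * norm b"
            using r(2) by (intro mult_right_mono mult_left_mono) auto
          finally have "- (2 * Re (cnj a * g x * b)) \<le> r * (2 * (norm a * norm b))"
            by (simp add: algebra_simps)
          also have "\<dots> \<le> r * ((norm a)\<^sup>2 + (norm b)\<^sup>2)"
            using sum_squares_bound[of "norm a" "norm b"] order_trans[OF norm_ge_zero r(2)]
            by (intro mult_left_mono) (auto simp: algebra_simps)
          finally show ?thesis by simp
        qed
        ultimately show "0 \<le> (\<Sum>i\<in>?I. \<Sum>j\<in>?I. cnj (v i) * F i j x * v j)"
          by (simp add: complex_nonneg_iff)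
      qed
    qed
  qed
  moreover have "completely_positive p M N 2 ?\<Phi>" using pair by (simp add: dec_pairs_def)
  ultimately have "amplification ?\<Phi> F \<in> Sp_cone p N ?I"
    unfolding completely_positive_def by blast
  then have "AE y in N. psd_on ?I (\<lambda>i j. amplification ?\<Phi> F i j y)"
    by (simp add: Sp_cone_def)
  then show ?thesis
  proof eventually_elim
    case (elim y)
    have form: "0 \<le> cnj a * v1 f y * a + cnj a * T g y * b + cnj b * cnj (T g y) * a + cnj b * v2 f y * b"
      for a b
    proof -
      have "0 \<le> (\<Sum>i\<in>?I. \<Sum>j\<in>?I. cnj (if snd i = 0 then a else b) * amplification ?\<Phi> F i j y
        * (if snd j = 0 then a else b))"
        using elim[unfolded psd_on_def, rule_format, of "\<lambda>i. if snd i = 0 then a else b"] .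
      then show ?thesis
        unfolding sum_times_2
        by (simp add: amplification_def block_map_def F_def conj_map_def algebra_simps)
    qed
    have "0 \<le> (v1 f y + v2 f y) + cnj w * T g y + w * cnj (T g y)" if w: "norm w = 1" for w
    proof -
      have "w * cnj w = 1" using w complex_norm_square[of w] by simp
      then have w_cancel: "w * (cnj w * z) = z" for z by (simp flip: mult.assoc)
      show ?thesis using form[of w 1] by (simp add: algebra_simps w_cancel)
    qed
    from hermitian_from_rotations(2)[OF this] form[of 1 0] form[of 0 1]
    show ?case by simp
  qed
qed

text \<open>
  By the least upper bound property, \<open>A |f|\<close> lies below the average of \<open>v1 |f|\<close> and \<open>v2 |f|\<close>.
  Convexity of the \<open>p\<close>-th power bounds the norm of an average by the larger of the two norms.
\<close>

lemma modulus_Lp_norm_le: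
  assumes p: "1 \<le> p" and A: "is_modulus p M N T A" and pair: "(v1, v2) \<in> dec_pairs p M N T"
    and f: "f \<in> Lp p M"
    and k: "Lp_norm p N (v1 (\<lambda>x. of_real (norm (f x)))) \<le> k"
           "Lp_norm p N (v2 (\<lambda>x. of_real (norm (f x)))) \<le> k"
  shows "Lp_norm p N (A f) \<le> k"
proof -
  let ?n = "\<lambda>x. complex_of_real (norm (f x))"
  have p0: "0 \<le> p" "0 < p" using p by auto
  have k0: "0 \<le> k" using k(1) Lp_norm_nonneg by (rule order_trans[rotated])
  have n: "?n \<in> Lp p M" by (rule Lp_norm_fun[OF f])
  have v: "v1 ?n \<in> Lp p N" "v2 ?n \<in> Lp p N"
    using pair n by (auto simp: dec_pairs_def intro: Lp_linear_in)
  have h: "(\<lambda>y. 1/2 * (v1 ?n y + v2 ?n y)) \<in> Lp p N"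
    by (intro Lp_cmult Lp_add p0 v)
  have nonneg: "AE y in N. 0 \<le> v1 ?n y \<and> 0 \<le> v2 ?n y"
    using dec_pair_bound[OF p0(1) pair n f] by auto
  have "AE y in N. A ?n y \<le> 1/2 * (v1 ?n y + v2 ?n y)"
  proof (rule is_modulus_least[OF A n _ h])
    fix g assume "g \<in> Lp p M" "AE x in M. of_real (norm (g x)) \<le> ?n x"
    from dec_pair_bound[OF p0(1) pair n this]
    show "AE y in N. of_real (norm (T g y)) \<le> 1/2 * (v1 ?n y + v2 ?n y)"
      by eventually_elim (simp add: less_eq_complex_def)
  qed (simp add: complex_nonneg_iff)
  with positive_linear_norm_le[OF p0(1) is_modulus_linear[OF A] is_modulus_positive[OF A] f] nonneg
  have pointwise: "AE y in N. norm (A f y) powr p \<le> (norm (v1 ?n y) powr p + norm (v2 ?n y) powr p) / 2"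
  proof eventually_elim
    case (elim y)
    have "norm (v1 ?n y) = Re (v1 ?n y)" "norm (v2 ?n y) = Re (v2 ?n y)"
      using elim by (simp_all add: complex_nonneg_iff cmod_eq_Re)
    with elim have "norm (A f y) \<le> (norm (v1 ?n y) + norm (v2 ?n y)) / 2"
      by (simp add: less_eq_complex_def)
    then have "norm (A f y) powr p \<le> ((norm (v1 ?n y) + norm (v2 ?n y)) / 2) powr p"
      using p0 by (intro powr_mono2) auto
    also have "\<dots> \<le> (norm (v1 ?n y) powr p + norm (v2 ?n y) powr p) / 2"
      using p by (intro powr_midpoint_convex) auto
    finally show ?case .
  qed
  have "(\<integral>y. norm (A f y) powr p \<partial>N) \<le> (\<integral>y. (norm (v1 ?n y) powr p + norm (v2 ?n y) powr p) / 2 \<partial>N)"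
    using pointwise v by (intro integral_mono_AE') (auto intro!: Lp_integrable)
  also have "\<dots> = ((\<integral>y. norm (v1 ?n y) powr p \<partial>N) + (\<integral>y. norm (v2 ?n y) powr p \<partial>N)) / 2"
    using v by (simp add: Lp_integrable)
  also have "\<dots> \<le> k powr p"
    using k p0 k0 by (simp add: Lp_norm_le_iff)
  finally show ?thesis using p0 k0 by (simp add: Lp_norm_le_iff)
qed

text \<open>
  Comparing admissible constants instead of norms covers unbounded \<open>v1\<close> or \<open>v2\<close>: if the
  inequality failed, constants \<open>C1\<close>, \<open>C2\<close> for \<open>v1\<close>, \<open>v2\<close> would exist below the norm of \<open>A\<close>, although
  their maximum is a constant for \<open>A\<close>.
\<close>

lemma modulus_opnorm_le:
  assumes p: "1 \<le> p" and A: "is_modulus p M N T A" and pair: "(v1, v2) \<in> dec_pairs p M N T"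
  shows "Lp_opnorm p M N A \<le> max (Lp_opnorm p M N v1) (Lp_opnorm p M N v2)"
proof (rule ccontr)
  assume "\<not> ?thesis"
  then have "Lp_opnorm p M N v1 < Lp_opnorm p M N A" "Lp_opnorm p M N v2 < Lp_opnorm p M N A"
    by (auto simp: not_le)
  then obtain C1 C2 where C: "C1 < Lp_opnorm p M N A" "C2 < Lp_opnorm p M N A"
    and C1: "\<And>f. f \<in> Lp p M \<Longrightarrow> ennreal (Lp_norm p N (v1 f)) \<le> C1 * ennreal (Lp_norm p M f)"
    and C2: "\<And>f. f \<in> Lp p M \<Longrightarrow> ennreal (Lp_norm p N (v2 f)) \<le> C2 * ennreal (Lp_norm p M f)"
    unfolding Lp_opnorm_def[of p M N v1] Lp_opnorm_def[of p M N v2] Inf_less_iff by blast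
  have "ennreal (Lp_norm p N (A f)) \<le> max C1 C2 * ennreal (Lp_norm p M f)" if f: "f \<in> Lp p M" for f
  proof (cases "max C1 C2 * ennreal (Lp_norm p M f)")
    case (real k)
    let ?n = "\<lambda>x. complex_of_real (norm (f x))"
    have n: "?n \<in> Lp p M" "Lp_norm p M ?n = Lp_norm p M f"
      using Lp_norm_fun[OF f] by (auto simp: Lp_norm_def)
    have "ennreal (Lp_norm p N (v1 ?n)) \<le> ennreal k" "ennreal (Lp_norm p N (v2 ?n)) \<le> ennreal k"
      using C1[OF n(1)] C2[OF n(1)] unfolding n(2) real(2)[symmetric]
      by (auto intro: order_trans[OF _ mult_right_mono])
    then have "Lp_norm p N (A f) \<le> k"
      using real(1) by (intro modulus_Lp_norm_le[OF p A pair f]) (auto simp: ennreal_le_iff)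
    then show ?thesis unfolding real(2) by (rule ennreal_leI)
  qed simp
  then have "Lp_opnorm p M N A \<le> max C1 C2" unfolding Lp_opnorm_def by (intro Inf_lower) auto
  with C show False by (auto simp: max_def split: if_splits)
qed

lemma dec_norm_eq_modulus:
  assumes p: "1 \<le> p" and A: "is_modulus p M N T A" and pair: "(A, A) \<in> dec_pairs p M N T"
  shows "dec_norm p M N T = max (Lp_opnorm p M N A) (Lp_opnorm p M N A)"
  unfolding dec_norm_def
proof (intro antisym INF_greatest)
  show "(INF (v1, v2)\<in>dec_pairs p M N T. max (Lp_opnorm p M N v1) (Lp_opnorm p M N v2))
    \<le> max (Lp_opnorm p M N A) (Lp_opnorm p M N A)"
    by (rule INF_lower2[OF pair]) simp
qed (use modulus_opnorm_le[OF p A] in auto)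

section \<open>Essential suprema of families with bounded maxima\<close>

text \<open>
  Exhaustion: among all countable subfamilies, the integral of the supremum is bounded by \<open>K\<close> and
  its supremum is attained by some \<open>D\<close>, a union of a maximizing sequence.  Adjoining one more function
  to \<open>D\<close> cannot increase the finite integral, so that function lies below the supremum of \<open>D\<close> almost
  everywhere.
\<close>

lemma countable_essential_supremum:
  fixes \<Phi> :: "('b \<Rightarrow> ennreal) set"
  assumes meas: "\<And>u. u \<in> \<Phi> \<Longrightarrow> u \<in> borel_measurable N"
    and bound: "\<And>F. finite F \<Longrightarrow> F \<subseteq> \<Phi> \<Longrightarrow> (\<integral>\<^sup>+y. (SUP u\<in>F. u y) \<partial>N) \<le> K"
    and K: "K < \<infinity>"
  obtains D where "countable D" "D \<subseteq> \<Phi>" "(\<integral>\<^sup>+y. (SUP u\<in>D. u y) \<partial>N) \<le> K"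
    "\<And>u. u \<in> \<Phi> \<Longrightarrow> AE y in N. u y \<le> (SUP v\<in>D. v y)"
proof -
  define J where "J D = (\<integral>\<^sup>+y. (SUP u\<in>D. u y) \<partial>N)" for D
  define \<D> where "\<D> = {D. countable D \<and> D \<subseteq> \<Phi>}"
  have J_le: "J D \<le> K" if "D \<in> \<D>" for D
  proof (cases "D = {}")
    case True
    then show ?thesis by (simp add: J_def bot_ennreal)
  next
    case False
    define e where "e = from_nat_into D"
    have De: "D = range e"
      using that False by (simp add: e_def \<D>_def range_from_nat_into)
    have "J D = (\<integral>\<^sup>+y. (SUP k. SUP u\<in>e ` {..k}. u y) \<partial>N)"
      unfolding J_def De
    proof (intro nn_integral_cong antisym SUP_least)
      fix y u assume "u \<in> range e"
      then obtain k where "u = e k" by blast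
      then show "u y \<le> (SUP k. SUP u\<in>e ` {..k}. u y)"
        by (intro SUP_upper2[of k]) (auto intro!: SUP_upper)
    next
      fix y k u assume "u \<in> e ` {..k}"
      then show "u y \<le> (SUP u\<in>range e. u y)" by (auto intro!: SUP_upper)
    qed
    also have "\<dots> = (SUP k. J (e ` {..k}))"
      unfolding J_def
    proof (rule nn_integral_monotone_convergence_SUP)
      show "incseq (\<lambda>k y. SUP u\<in>e ` {..k}. u y)"
        by (intro incseq_SucI le_funI SUP_subset_mono) auto
      show "(\<lambda>y. SUP u\<in>e ` {..k}. u y) \<in> borel_measurable N" for k
        using that De by (intro borel_measurable_SUP meas) (auto simp: \<D>_def)
    qed
    also have "\<dots> \<le> K"
      using that De unfolding J_def by (intro SUP_least bound) (auto simp: \<D>_def)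
    finally show ?thesis .
  qed
  have "{} \<in> \<D>" by (simp add: \<D>_def)
  then obtain f :: "nat \<Rightarrow> ennreal" where f: "range f \<subseteq> J ` \<D>" "Sup (J ` \<D>) = Sup (range f)"
    using ennreal_SUP_countable_SUP[of \<D> J] by blast
  then have "\<forall>n. \<exists>D\<in>\<D>. f n = J D" by blast
  then obtain E where E: "\<And>n. E n \<in> \<D>" "\<And>n. f n = J (E n)" by metis
  define D where "D = (\<Union>n. E n)"
  have D: "D \<in> \<D>" using E(1) by (auto simp: D_def \<D>_def)
  have max: "J D' \<le> J D" if "D' \<in> \<D>" for D'
  proof -
    have "J D' \<le> Sup (J ` \<D>)" using that by (rule SUP_upper)
    also have "\<dots> \<le> J D"
      unfolding f(2) E(2)
      unfolding J_def D_def by (intro SUP_least nn_integral_mono SUP_subset_mono) auto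
    finally show ?thesis .
  qed
  show thesis
  proof (rule that[of D])
    show "countable D" "D \<subseteq> \<Phi>" using D by (auto simp: \<D>_def)
    show "(\<integral>\<^sup>+y. (SUP u\<in>D. u y) \<partial>N) \<le> K" using J_le[OF D] by (simp add: J_def)
    fix u assume u: "u \<in> \<Phi>"
    let ?h = "\<lambda>y. SUP v\<in>D. v y" and ?h' = "\<lambda>y. SUP v\<in>insert u D. v y"
    have D': "insert u D \<in> \<D>" using D u by (simp add: \<D>_def)
    have "(\<lambda>y. SUP v\<in>E. v y) \<in> borel_measurable N" if "E \<in> \<D>" for E
      using that by (intro borel_measurable_SUP meas) (auto simp: \<D>_def)
    from this[OF D] this[OF D'] have m: "?h \<in> borel_measurable N" "?h' \<in> borel_measurable N" .
    have "(\<integral>\<^sup>+y. ?h' y - ?h y \<partial>N) = J (insert u D) - J D"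
      unfolding J_def using J_le[OF D] K
      by (intro nn_integral_diff m AE_I2 SUP_subset_mono) (auto simp: J_def top_unique)
    also have "\<dots> = 0"
      using max[OF D'] order_le_less_trans[OF J_le[OF D'] K] by (simp add: diff_eq_0_iff_ennreal)
    finally have "AE y in N. ?h' y - ?h y = 0"
      using m by (subst (asm) nn_integral_0_iff_AE) auto
    then show "AE y in N. u y \<le> ?h y"
      by eventually_elim (auto dest!: ennreal_minus_eq_0)
  qed
qed

section \<open>Regularity bounds finite maxima\<close>

definition nonneg_Lp :: "real \<Rightarrow> 'a measure \<Rightarrow> ('a \<Rightarrow> real) set" where
  "nonneg_Lp p M = {u \<in> borel_measurable M. (\<forall>x. 0 \<le> u x) \<and> integrable M (\<lambda>x. u x powr p)}"

definition Lp_interval :: "real \<Rightarrow> 'a measure \<Rightarrow> ('a \<Rightarrow> real) \<Rightarrow> ('a \<Rightarrow> complex) set" where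
  "Lp_interval p M u = {g \<in> Lp p M. AE x in M. norm (g x) \<le> u x}"

lemma nonneg_Lp_of_real: "u \<in> nonneg_Lp p M \<Longrightarrow> (\<lambda>x. complex_of_real (u x)) \<in> Lp p M"
  by (auto simp: nonneg_Lp_def intro!: Lp_I)

lemma nonneg_LpI:
  assumes "(\<lambda>x. complex_of_real (u x)) \<in> Lp p M" "\<And>x. 0 \<le> u x"
  shows "u \<in> nonneg_Lp p M"
proof -
  have "(\<lambda>x. Re (complex_of_real (u x))) \<in> borel_measurable M"
    using Lp_measurable[OF assms(1)] by measurable
  with assms Lp_integrable[OF assms(1)] show ?thesis by (simp add: nonneg_Lp_def)
qed

lemma nonneg_Lp_add:
  assumes "0 \<le> p" "u \<in> nonneg_Lp p M" "v \<in> nonneg_Lp p M"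
  shows "(\<lambda>x. u x + v x) \<in> nonneg_Lp p M"
  using Lp_add[OF assms(1) nonneg_Lp_of_real[OF assms(2)] nonneg_Lp_of_real[OF assms(3)]] assms
  by (intro nonneg_LpI) (auto simp: nonneg_Lp_def)

lemma nonneg_Lp_cmult:
  assumes "0 \<le> c" "u \<in> nonneg_Lp p M"
  shows "(\<lambda>x. c * u x) \<in> nonneg_Lp p M"
  using Lp_cmult[OF nonneg_Lp_of_real[OF assms(2)], of "of_real c"] assms
  by (intro nonneg_LpI) (auto simp: nonneg_Lp_def)

lemma nonneg_Lp_dominated:
  assumes p: "0 \<le> p" and f: "f \<in> Lp p M" and m: "u \<in> borel_measurable M"
    and u: "\<And>x. 0 \<le> u x" "\<And>x. u x \<le> norm (f x)"
  shows "u \<in> nonneg_Lp p M"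
  by (rule nonneg_LpI[OF Lp_dominated[OF p _ f]]) (use m u in auto)

lemma nonneg_Lp_norm: "0 \<le> p \<Longrightarrow> f \<in> Lp p M \<Longrightarrow> (\<lambda>x. norm (f x)) \<in> nonneg_Lp p M"
  by (rule nonneg_Lp_dominated) (auto intro: borel_measurable_norm Lp_measurable)

lemma nonneg_Lp_positive_part:
  assumes p: "0 \<le> p" and r: "(\<lambda>x. complex_of_real (r x)) \<in> Lp p M"
  shows "(\<lambda>x. max 0 (r x)) \<in> nonneg_Lp p M" "(\<lambda>x. max 0 (- r x)) \<in> nonneg_Lp p M"
proof -
  have "(\<lambda>x. Re (complex_of_real (r x))) \<in> borel_measurable M"
    using Lp_measurable[OF r] by measurable
  then have [measurable]: "r \<in> borel_measurable M" by simp
  show "(\<lambda>x. max 0 (r x)) \<in> nonneg_Lp p M" "(\<lambda>x. max 0 (- r x)) \<in> nonneg_Lp p M"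
    by (rule nonneg_Lp_dominated[OF p r]; (measurable | simp))+
qed

lemma Lp_interval_mono:
  "g \<in> Lp_interval p M u \<Longrightarrow> AE x in M. u x \<le> v x \<Longrightarrow> g \<in> Lp_interval p M v"
  by (auto simp: Lp_interval_def elim: eventually_elim2)

text \<open>
  On sequences vanishing from index \<open>n\<close> on, this is the norm of \<open>\<complex>\<^sup>n\<close> with the maximum norm.
  The inserted \<open>0\<close> makes the maximum meaningful for \<open>n = 0\<close>.
\<close>

definition coordinate_max :: "nat \<Rightarrow> (nat \<Rightarrow> complex) \<Rightarrow> real" where
  "coordinate_max n v = Max (insert 0 ((\<lambda>k. norm (v k)) ` {..<n}))"

lemma coordinate_max_nonneg: "0 \<le> coordinate_max n v"
  by (simp add: coordinate_max_def)

lemma norm_le_coordinate_max: "k < n \<Longrightarrow> norm (v k) \<le> coordinate_max n v"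
  by (auto simp: coordinate_max_def intro!: Max_ge)

lemma coordinate_max_le_iff: "coordinate_max n v \<le> a \<longleftrightarrow> 0 \<le> a \<and> (\<forall>k<n. norm (v k) \<le> a)"
  by (auto simp: coordinate_max_def)

lemma coordinate_max_cong: "(\<And>k. k < n \<Longrightarrow> u k = v k) \<Longrightarrow> coordinate_max n u = coordinate_max n v"
  by (auto simp: coordinate_max_def intro!: arg_cong[where f = Max])

lemma coordinate_max_scale: "coordinate_max n (\<lambda>k. c * v k) = norm c * coordinate_max n v"
proof (rule antisym)
  show "coordinate_max n (\<lambda>k. c * v k) \<le> norm c * coordinate_max n v"
    by (auto simp: coordinate_max_le_iff norm_mult coordinate_max_nonneg
        intro!: mult_left_mono norm_le_coordinate_max)
  show "norm c * coordinate_max n v \<le> coordinate_max n (\<lambda>k. c * v k)"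
  proof (cases "c = 0")
    case False
    have "coordinate_max n v \<le> coordinate_max n (\<lambda>k. c * v k) / norm c"
      using norm_le_coordinate_max[of _ n "\<lambda>k. c * v k"] False
      by (auto simp: coordinate_max_le_iff coordinate_max_nonneg norm_mult field_simps)
    then show ?thesis using False by (simp add: field_simps)
  qed (simp add: coordinate_max_nonneg)
qed

text \<open>
  Completeness: limits are taken in each coordinate, and the maximum norm is at most the sum of the
  coordinate norms, which tends to \<open>0\<close> as there are only \<open>n\<close> coordinates.
\<close>

lemma complex_banach_coordinate_max:
  "complex_banach {v. \<forall>k\<ge>n. v k = 0} (coordinate_max n)"
  unfolding complex_banach_def
proof (intro conjI ballI allI impI)
  fix v :: "nat \<Rightarrow> complex" assume v: "v \<in> {v. \<forall>k\<ge>n. v k = 0}"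
  show "coordinate_max n v = 0 \<longleftrightarrow> v = (\<lambda>_. 0)"
  proof
    assume "coordinate_max n v = 0"
    then have "v k = 0" for k
      using v norm_le_coordinate_max[of k n v] by (cases "k < n") auto
    then show "v = (\<lambda>_. 0)" by auto
  next
    assume "v = (\<lambda>_. 0)"
    then show "coordinate_max n v = 0"
      using coordinate_max_le_iff[of n v 0] coordinate_max_nonneg[of n v] by auto
  qed
next
  fix u v :: "nat \<Rightarrow> complex"
  show "coordinate_max n (\<lambda>k. u k + v k) \<le> coordinate_max n u + coordinate_max n v"
    by (auto simp: coordinate_max_le_iff coordinate_max_nonneg
        intro!: norm_triangle_mono norm_le_coordinate_max)
next
  fix s :: "nat \<Rightarrow> nat \<Rightarrow> complex"
  assume "(\<forall>i. s i \<in> {v. \<forall>k\<ge>n. v k = 0}) \<and>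
    (\<forall>e>0. \<exists>n0. \<forall>m\<ge>n0. \<forall>l\<ge>n0. coordinate_max n (\<lambda>k. s m k - s l k) < e)"
  then have s: "\<And>i k. k \<ge> n \<Longrightarrow> s i k = 0"
    and cauchy: "\<And>e. e > 0 \<Longrightarrow> \<exists>n0. \<forall>m\<ge>n0. \<forall>l\<ge>n0. coordinate_max n (\<lambda>k. s m k - s l k) < e"
    by auto
  have "Cauchy (\<lambda>i. s i k)" if "k < n" for k
  proof (rule metric_CauchyI)
    fix e :: real assume "e > 0"
    from cauchy[OF this] obtain n0 where
      n0: "\<And>m l. m \<ge> n0 \<Longrightarrow> l \<ge> n0 \<Longrightarrow> coordinate_max n (\<lambda>k. s m k - s l k) < e" by blast
    have "dist (s m k) (s l k) < e" if "m \<ge> n0" "l \<ge> n0" for m l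
      using norm_le_coordinate_max[OF \<open>k < n\<close>, of "\<lambda>k. s m k - s l k"] n0[OF that]
      by (simp add: dist_norm)
    then show "\<exists>n0. \<forall>m\<ge>n0. \<forall>l\<ge>n0. dist (s m k) (s l k) < e" by blast
  qed
  then have lim: "(\<lambda>i. s i k) \<longlonglongrightarrow> lim (\<lambda>i. s i k)" if "k < n" for k
    using that by (simp add: Cauchy_convergent_iff convergent_LIMSEQ_iff)
  define v where "v k = (if k < n then lim (\<lambda>i. s i k) else 0)" for k
  show "\<exists>v\<in>{v. \<forall>k\<ge>n. v k = 0}. (\<lambda>i. coordinate_max n (\<lambda>k. s i k - v k)) \<longlonglongrightarrow> 0"
  proof
    show "v \<in> {v. \<forall>k\<ge>n. v k = 0}" by (simp add: v_def)
    have "(\<lambda>i. \<Sum>k<n. norm (s i k - v k)) \<longlonglongrightarrow> (\<Sum>k<n. norm (v k - v k))"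
      using lim by (intro tendsto_intros) (auto simp: v_def)
    then have "(\<lambda>i. \<Sum>k<n. norm (s i k - v k)) \<longlonglongrightarrow> 0" by simp
    then show "(\<lambda>i. coordinate_max n (\<lambda>k. s i k - v k)) \<longlonglongrightarrow> 0"
    proof (rule tendsto_sandwich[OF _ _ tendsto_const, rotated 2])
      show "\<forall>\<^sub>F i in sequentially. 0 \<le> coordinate_max n (\<lambda>k. s i k - v k)"
        by (simp add: coordinate_max_nonneg)
      show "\<forall>\<^sub>F i in sequentially. coordinate_max n (\<lambda>k. s i k - v k) \<le> (\<Sum>k<n. norm (s i k - v k))"
        by (intro always_eventually allI)
          (auto simp: coordinate_max_le_iff sum_nonneg intro!: member_le_sum)
    qed
  qed
qed (auto simp: coordinate_max_nonneg coordinate_max_scale)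

text \<open>
  With the unit vectors as second factors, the tensor \<open>\<Sum>i<n. g i \<otimes> e i\<close> is the vector-valued function
  with coordinates \<open>g i\<close>, so its Bochner norm is the norm of a finite maximum.
\<close>

lemma Bochner_norm_coordinate_max:
  "Bochner_norm p M (coordinate_max n) (tensor_sum n g (\<lambda>i k. if k = i then 1 else 0)) =
   (\<integral>x. coordinate_max n (\<lambda>i. g i x) powr p \<partial>M) powr (1 / p)"
proof -
  have "coordinate_max n (tensor_sum n g (\<lambda>i k. if k = i then 1 else 0) x)
      = coordinate_max n (\<lambda>i. g i x)" for x
    by (rule coordinate_max_cong)
       (simp add: tensor_sum_def if_distrib[of "\<lambda>t. _ * t"] sum.delta' cong: if_cong)
  then show ?thesis by (simp add: Bochner_norm_def)
qed

text \<open>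
  The constant is uniform in \<open>n\<close> since regularity takes a supremum over all Banach spaces.
\<close>

lemma regular_maximal_bound:
  assumes p: "0 < p" and reg: "regular_operator p M N T"
  obtains c where "0 \<le> c"
    "\<And>u n g. u \<in> nonneg_Lp p M \<Longrightarrow> (\<And>i. i < n \<Longrightarrow> g i \<in> Lp_interval p M u) \<Longrightarrow>
      (\<integral>y. coordinate_max n (\<lambda>i. T (g i) y) powr p \<partial>N) \<le> c * (\<integral>x. u x powr p \<partial>M)"
proof -
  define R where "R = (SUP (V, \<nu>) \<in> {(V, \<nu>). complex_banach V \<nu>}. tensor_Id_opnorm p M N T V \<nu>)"
  have "R < \<infinity>" using reg by (simp add: regular_operator_def R_def)
  \<comment> \<open>a constant strictly above the supremum, since the infimum defining each norm need not be
    attained\<close>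
  then obtain C where C: "R < C" "C < \<infinity>" using dense by blast
  define c where "c = enn2real C"
  have c: "C = ennreal c" "0 \<le> c" using C(2) by (auto simp: c_def)
  show thesis
  proof (rule that[of "c powr p"])
    fix u and n :: nat and g
    assume u: "u \<in> nonneg_Lp p M" and g: "\<And>i. i < n \<Longrightarrow> g i \<in> Lp_interval p M u"
    define V where "V = {v :: nat \<Rightarrow> complex. \<forall>k\<ge>n. v k = 0}"
    define e :: "nat \<Rightarrow> nat \<Rightarrow> complex" where "e i k = (if k = i then 1 else 0)" for i k
    let ?\<nu> = "coordinate_max n"
    have "tensor_Id_opnorm p M N T V ?\<nu> \<le> R"
      unfolding R_def V_def
      by (rule SUP_upper2[where i = "({v. \<forall>k\<ge>n. v k = 0}, coordinate_max n)"])
         (simp_all add: complex_banach_coordinate_max)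
    then have "tensor_Id_opnorm p M N T V ?\<nu> < C" using C(1) by (rule order_le_less_trans)
    then obtain C' where C': "C' < C"
      "\<And>n f x. (\<forall>i<n. f i \<in> Lp p M \<and> x i \<in> V) \<Longrightarrow>
        ennreal (Bochner_norm p N ?\<nu> (tensor_sum n (\<lambda>i. T (f i)) x))
          \<le> C' * ennreal (Bochner_norm p M ?\<nu> (tensor_sum n f x))"
      unfolding tensor_Id_opnorm_def Inf_less_iff by blast
    have "\<forall>i<n. g i \<in> Lp p M \<and> e i \<in> V"
      using g by (auto simp: Lp_interval_def V_def e_def)
    from C'(2)[OF this]
    have "ennreal (Bochner_norm p N ?\<nu> (tensor_sum n (\<lambda>i. T (g i)) e))
        \<le> C * ennreal (Bochner_norm p M ?\<nu> (tensor_sum n g e))"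
      by (rule order_trans) (use C'(1) in \<open>auto intro: mult_right_mono\<close>)
    then have le: "(\<integral>y. ?\<nu> (\<lambda>i. T (g i) y) powr p \<partial>N) powr (1 / p)
        \<le> c * (\<integral>x. ?\<nu> (\<lambda>i. g i x) powr p \<partial>M) powr (1 / p)" (is "?L powr _ \<le> c * ?R powr _")
      using c(2) unfolding e_def Bochner_norm_coordinate_max c(1)
      by (simp add: ennreal_mult[symmetric])
    have nn: "0 \<le> ?L" "0 \<le> ?R" by (auto intro: integral_nonneg_AE)
    have "?L = (?L powr (1 / p)) powr p" using p nn by (simp add: powr_powr)
    also have "\<dots> \<le> (c * ?R powr (1 / p)) powr p" using le p by (intro powr_mono2) auto
    also have "\<dots> = c powr p * ?R" using p nn by (simp add: powr_mult powr_powr)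
    also have "?R \<le> (\<integral>x. u x powr p \<partial>M)"
    proof (rule integral_mono_AE')
      have "AE x in M. \<forall>i\<in>{..<n}. norm (g i x) \<le> u x"
        using g by (intro AE_finite_allI) (auto simp: Lp_interval_def)
      then show "AE x in M. ?\<nu> (\<lambda>i. g i x) powr p \<le> u x powr p"
        by eventually_elim (use u p in \<open>auto intro!: powr_mono2
            simp: coordinate_max_nonneg coordinate_max_le_iff nonneg_Lp_def\<close>)
    qed (use u in \<open>auto simp: nonneg_Lp_def\<close>)
    finally show "?L \<le> c powr p * (\<integral>x. u x powr p \<partial>M)" by (simp add: mult_left_mono)
  qed simp
qed

section \<open>Existence of the modulus\<close>

text \<open>
  The essential supremum is formed for the functions \<open>|T g| powr p\<close>, whose finite maxima have
  bounded integrals; the \<open>p\<close>-th root of it is the least upper bound.  The comparison function \<open>k\<close>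
  may be arbitrary because only countably many \<open>g\<close> enter the supremum.
\<close>

lemma modulus_value_exists:
  assumes p: "0 < p" and T: "Lp_linear p M N T"
    and u: "\<And>x. 0 \<le> u x"
    and bound: "\<And>n g. (\<And>i. i < n \<Longrightarrow> g i \<in> Lp_interval p M u) \<Longrightarrow>
      (\<integral>y. coordinate_max n (\<lambda>i. T (g i) y) powr p \<partial>N) \<le> K"
  shows "\<exists>w\<in>nonneg_Lp p N.
    (\<forall>g\<in>Lp_interval p M u. AE y in N. norm (T g y) \<le> w y) \<and>
    (\<forall>k. (\<forall>g\<in>Lp_interval p M u. AE y in N. norm (T g y) \<le> k y) \<longrightarrow> (AE y in N. w y \<le> k y)) \<and>
    (\<integral>y. w y powr p \<partial>N) \<le> K"
proof -
  let ?I = "Lp_interval p M u"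
  define \<phi> where "\<phi> g y = ennreal (norm (T g y) powr p)" for g y
  have TI: "T g \<in> Lp p N" if "g \<in> ?I" for g
    using that by (auto simp: Lp_interval_def intro: Lp_linear_in[OF T])
  have K0: "0 \<le> K"
    using bound[of 0 "\<lambda>_ _. 0"] by (simp add: coordinate_max_def)
  have "(\<integral>\<^sup>+y. (SUP v\<in>F. v y) \<partial>N) \<le> ennreal K" if F: "finite F" "F \<subseteq> \<phi> ` ?I" for F
  proof -
    obtain G where G: "G \<subseteq> ?I" "finite G" "F = \<phi> ` G"
      using finite_subset_image[OF F] by blast
    obtain n and g :: "nat \<Rightarrow> 'a \<Rightarrow> complex" where ng: "G = g ` {i. i < n}"
      using G(2) unfolding finite_conv_nat_seg_image by blast
    have gI: "g i \<in> ?I" if "i < n" for i using that G(1) ng by auto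
    note Tg = TI[OF gI]
    let ?m = "\<lambda>y. coordinate_max n (\<lambda>i. T (g i) y)"
    have m: "?m \<in> borel_measurable N"
    proof -
      \<comment> \<open>a maximum over an index set that is not empty and carries the default \<open>0\<close> at index \<open>n\<close>\<close>
      have *: "?m = (\<lambda>y. Max ((\<lambda>i. if i < n then norm (T (g i) y) else 0) ` {..n}))"
      proof
        fix y
        have "insert 0 ((\<lambda>k. norm (T (g k) y)) ` {..<n}) =
              (\<lambda>i. if i < n then norm (T (g i) y) else 0) ` {..n}"
          by (auto simp: image_iff less_le)
        then show "?m y = Max ((\<lambda>i. if i < n then norm (T (g i) y) else 0) ` {..n})"
          by (simp add: coordinate_max_def)
      qed
      show ?thesis unfolding *
      proof (intro borel_measurable_Max)
        show "(\<lambda>y. if i < n then norm (T (g i) y) else 0) \<in> borel_measurable N" for i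
          using Lp_measurable[OF Tg, of i] by (cases "i < n") auto
      qed auto
    qed
    have int: "integrable N (\<lambda>y. ?m y powr p)"
    proof (rule Bochner_Integration.integrable_bound)
      show "integrable N (\<lambda>y. \<Sum>i<n. norm (T (g i) y) powr p)"
        by (intro Bochner_Integration.integrable_sum Lp_integrable Tg) auto
      have "?m y powr p \<le> (\<Sum>i<n. norm (T (g i) y) powr p)" for y
      proof -
        have "?m y \<in> insert 0 ((\<lambda>i. norm (T (g i) y)) ` {..<n})"
          unfolding coordinate_max_def by (rule Max_in) auto
        then show ?thesis
          by (auto intro!: sum_nonneg member_le_sum[where f = "\<lambda>i. norm (T (g i) y) powr p"])
      qed
      then show "AE y in N. norm (?m y powr p) \<le> norm (\<Sum>i<n. norm (T (g i) y) powr p)"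
        by (intro AE_I2) (simp add: sum_nonneg)
    qed (use m in measurable)
    have "(\<integral>\<^sup>+y. (SUP v\<in>F. v y) \<partial>N) \<le> (\<integral>\<^sup>+y. ennreal (?m y powr p) \<partial>N)"
      unfolding G(3) ng using p
      by (auto intro!: nn_integral_mono SUP_least ennreal_leI powr_mono2
          norm_le_coordinate_max[where v = "\<lambda>i. T (g i) y" for y] simp: \<phi>_def)
    also have "\<dots> = ennreal (\<integral>y. ?m y powr p \<partial>N)"
      using int by (intro nn_integral_eq_integral) auto
    also have "\<dots> \<le> ennreal K" by (intro ennreal_leI bound gI)
    finally show ?thesis .
  qed
  moreover have "v \<in> borel_measurable N" if "v \<in> \<phi> ` ?I" for v
    using that by (auto simp: \<phi>_def[abs_def] dest!: TI Lp_measurable)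
  ultimately obtain D where D: "countable D" "D \<subseteq> \<phi> ` ?I"
      "(\<integral>\<^sup>+y. (SUP v\<in>D. v y) \<partial>N) \<le> ennreal K"
      "\<And>v. v \<in> \<phi> ` ?I \<Longrightarrow> AE y in N. v y \<le> (SUP v\<in>D. v y)"
    and meas: "\<And>v. v \<in> \<phi> ` ?I \<Longrightarrow> v \<in> borel_measurable N"
    using countable_essential_supremum[of "\<phi> ` ?I" N "ennreal K"] by auto
  define h where "h y = (SUP v\<in>D. v y)" for y
  define w where "w y = enn2real (h y) powr (1 / p)" for y
  have h [measurable]: "h \<in> borel_measurable N"
    unfolding h_def[abs_def] using D(1,2) by (intro borel_measurable_SUP meas) auto
  have h_int: "(\<integral>\<^sup>+y. h y \<partial>N) \<le> ennreal K" using D(3) by (simp add: h_def)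
  then have "(\<integral>\<^sup>+y. h y \<partial>N) \<noteq> \<infinity>" by (auto simp: top_unique)
  then have h_fin: "AE y in N. h y \<noteq> \<infinity>" by (intro nn_integral_PInf_AE) auto
  have wp: "w y powr p = enn2real (h y)" for y
    using p by (simp add: w_def powr_powr)
  have wm: "w \<in> borel_measurable N" unfolding w_def[abs_def] by measurable
  have wh: "(\<integral>\<^sup>+y. ennreal (enn2real (h y)) \<partial>N) = (\<integral>\<^sup>+y. h y \<partial>N)"
    by (rule nn_integral_cong_AE) (use h_fin in \<open>auto elim!: eventually_mono simp: less_top\<close>)
  have root: "(norm z powr p) powr (1 / p) = norm z" for z :: complex
    using p by (simp add: powr_powr)
  show ?thesis
  proof (intro bexI conjI ballI allI impI)
    have "integrable N (\<lambda>y. enn2real (h y))"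
      using wh h_int by (intro integrableI_nonneg) (auto simp: order_le_less_trans)
    then show "w \<in> nonneg_Lp p N" using wm by (simp add: nonneg_Lp_def wp) (simp add: w_def)
    have "(\<integral>y. w y powr p \<partial>N) = enn2real (\<integral>\<^sup>+y. h y \<partial>N)"
      unfolding wp wh[symmetric] by (rule integral_eq_nn_integral) auto
    also have "\<dots> \<le> K" using enn2real_mono[OF h_int] K0 by simp
    finally show "(\<integral>y. w y powr p \<partial>N) \<le> K" .
  next
    fix g assume "g \<in> ?I"
    then have "AE y in N. \<phi> g y \<le> h y" unfolding h_def by (intro D(4)) auto
    with h_fin show "AE y in N. norm (T g y) \<le> w y"
    proof eventually_elim
      case (elim y)
      then have "enn2real (\<phi> g y) \<le> enn2real (h y)" by (intro enn2real_mono) (auto simp: less_top)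
      then have "(norm (T g y) powr p) powr (1 / p) \<le> w y"
        unfolding w_def using p by (intro powr_mono2) (auto simp: \<phi>_def)
      then show ?case by (simp only: root)
    qed
  next
    fix k assume k: "\<forall>g\<in>?I. AE y in N. norm (T g y) \<le> k y"
    have "(\<lambda>_. 0) \<in> ?I" using u by (simp add: Lp_interval_def Lp_zero)
    with k have k0: "AE y in N. 0 \<le> k y"
      by (force elim!: eventually_mono intro: order_trans[OF norm_ge_zero])
    have "AE y in N. \<forall>v\<in>D. v y \<le> ennreal (k y powr p)"
      unfolding AE_ball_countable[OF D(1)]
    proof
      fix v assume "v \<in> D"
      then obtain g where g: "g \<in> ?I" "v = \<phi> g" using D(2) by blast
      with k have "AE y in N. norm (T g y) \<le> k y" by blast
      then show "AE y in N. v y \<le> ennreal (k y powr p)"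
        unfolding g(2) \<phi>_def by eventually_elim (use p in \<open>auto intro!: ennreal_leI powr_mono2\<close>)
    qed
    with k0 show "AE y in N. w y \<le> k y"
    proof eventually_elim
      case (elim y)
      then have "h y \<le> ennreal (k y powr p)" unfolding h_def by (intro SUP_least) blast
      from enn2real_mono[OF this] have "enn2real (h y) \<le> k y powr p" by simp
      then have "w y \<le> (k y powr p) powr (1 / p)"
        unfolding w_def using p by (intro powr_mono2) auto
      with elim p show ?case by (simp add: powr_powr)
    qed
  qed
qed

text \<open>
  \<open>B u\<close> is a chosen representative of the least upper bound of the functions \<open>|T g|\<close> with
  \<open>|g| \<le> u\<close>.  Being determined almost everywhere by this property, \<open>B\<close> inherits its algebraic
  properties from \<open>T\<close>.
\<close>

locale cone_modulus =
  fixes p :: real and M :: "'a measure" and N :: "'b measure"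
    and T :: "('a \<Rightarrow> complex) \<Rightarrow> 'b \<Rightarrow> complex"
    and B :: "('a \<Rightarrow> real) \<Rightarrow> 'b \<Rightarrow> real" and c :: real
  assumes p: "1 \<le> p"
    and T: "Lp_linear p M N T"
    and B_in: "u \<in> nonneg_Lp p M \<Longrightarrow> B u \<in> nonneg_Lp p N"
    and B_upper: "u \<in> nonneg_Lp p M \<Longrightarrow> g \<in> Lp_interval p M u \<Longrightarrow> AE y in N. norm (T g y) \<le> B u y"
    and B_least: "u \<in> nonneg_Lp p M \<Longrightarrow>
      (\<And>g. g \<in> Lp_interval p M u \<Longrightarrow> AE y in N. norm (T g y) \<le> k y) \<Longrightarrow> AE y in N. B u y \<le> k y"
    and c: "0 \<le> c"
    and B_bound: "u \<in> nonneg_Lp p M \<Longrightarrow>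
      (\<integral>y. B u y powr p \<partial>N) \<le> c * (\<integral>x. u x powr p \<partial>M)"
begin

lemma p0: "0 \<le> p" "0 < p" using p by auto

lemma B_nonneg: "u \<in> nonneg_Lp p M \<Longrightarrow> 0 \<le> B u y"
  using B_in by (auto simp: nonneg_Lp_def)

lemma B_mono:
  assumes u: "u \<in> nonneg_Lp p M" and v: "v \<in> nonneg_Lp p M" and le: "AE x in M. u x \<le> v x"
  shows "AE y in N. B u y \<le> B v y"
  using B_least[OF u B_upper[OF v Lp_interval_mono[OF _ le]]] .

lemma B_cong:
  assumes "u \<in> nonneg_Lp p M" "v \<in> nonneg_Lp p M" "AE x in M. u x = v x"
  shows "AE y in N. B u y = B v y"
proof -
  have "AE x in M. u x \<le> v x" "AE x in M. v x \<le> u x"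
    using assms(3) by (auto elim: eventually_mono)
  from B_mono[OF assms(1,2) this(1)] B_mono[OF assms(2,1) this(2)]
  show ?thesis by eventually_elim simp
qed

lemma B_cmult_le:
  assumes a: "0 < a" and u: "u \<in> nonneg_Lp p M"
  shows "AE y in N. B (\<lambda>x. a * u x) y \<le> a * B u y"
proof (rule B_least)
  show "(\<lambda>x. a * u x) \<in> nonneg_Lp p M" using a u by (intro nonneg_Lp_cmult) auto
  fix g assume g: "g \<in> Lp_interval p M (\<lambda>x. a * u x)"
  define g' where "g' x = of_real (1 / a) * g x" for x
  have "g \<in> Lp p M" using g by (simp add: Lp_interval_def)
  then have g'_Lp: "g' \<in> Lp p M" unfolding g'_def[abs_def] by (rule Lp_cmult)
  moreover have "AE x in M. norm (g x) \<le> a * u x" using g by (simp add: Lp_interval_def)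
  then have "AE x in M. norm (g' x) \<le> u x"
    by eventually_elim (use a in \<open>simp add: g'_def norm_divide field_simps\<close>)
  ultimately have "AE y in N. norm (T g' y) \<le> B u y"
    by (intro B_upper[OF u]) (simp add: Lp_interval_def)
  moreover have "(\<lambda>x. of_real a * g' x) = g" using a by (auto simp: g'_def)
  then have "AE y in N. T g y = of_real a * T g' y"
    using Lp_linear_cmult[OF T g'_Lp, of "of_real a"] by simp
  ultimately show "AE y in N. norm (T g y) \<le> a * B u y"
    by eventually_elim (use a in \<open>simp add: norm_mult\<close>)
qed

lemma B_cmult:
  assumes a: "0 \<le> a" and u: "u \<in> nonneg_Lp p M"
  shows "AE y in N. B (\<lambda>x. a * u x) y = a * B u y"
proof (cases "a = 0")
  case True
  have z: "(\<lambda>x. 0 * u x) \<in> nonneg_Lp p M" using u by (intro nonneg_Lp_cmult) auto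
  have "AE y in N. B (\<lambda>x. 0 * u x) y \<le> 0"
  proof (rule B_least[OF z])
    fix g assume g: "g \<in> Lp_interval p M (\<lambda>x. 0 * u x)"
    then have "g \<in> Lp p M" "AE x in M. g x = 0" by (auto simp: Lp_interval_def)
    from Lp_linear_cong[OF T this(1) Lp_zero this(2)] Lp_linear_zero[OF T]
    show "AE y in N. norm (T g y) \<le> 0" by eventually_elim simp
  qed
  then show ?thesis unfolding True by eventually_elim (use B_nonneg[OF z] in \<open>simp add: antisym\<close>)
next
  case False
  with a have a: "0 < a" by simp
  have au: "(\<lambda>x. a * u x) \<in> nonneg_Lp p M" using a u by (intro nonneg_Lp_cmult) auto
  have "(\<lambda>x. (1 / a) * (a * u x)) = u" using a by auto
  with B_cmult_le[OF _ au, of "1 / a"] a have "AE y in N. B u y \<le> (1 / a) * B (\<lambda>x. a * u x) y"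
    by simp
  with B_cmult_le[OF a u] show ?thesis
    by eventually_elim (use a in \<open>simp add: field_simps\<close>)
qed

text \<open>
  Riesz decomposition: a function dominated by \<open>u + v\<close> splits into parts proportional to \<open>u\<close> and \<open>v\<close>.
  Where \<open>u + v\<close> vanishes, so does the function, and division by zero yields the correct value \<open>0\<close>.
\<close>

lemma B_subadditive:
  assumes u: "u \<in> nonneg_Lp p M" and v: "v \<in> nonneg_Lp p M"
  shows "AE y in N. B (\<lambda>x. u x + v x) y \<le> B u y + B v y"
proof (rule B_least)
  show "(\<lambda>x. u x + v x) \<in> nonneg_Lp p M" by (intro nonneg_Lp_add p0 u v)
  fix g assume "g \<in> Lp_interval p M (\<lambda>x. u x + v x)"
  then have g: "g \<in> Lp p M" and le: "AE x in M. norm (g x) \<le> u x + v x"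
    by (auto simp: Lp_interval_def)
  have nn: "0 \<le> u x" "0 \<le> v x" for x using u v by (auto simp: nonneg_Lp_def)
  have [measurable]: "u \<in> borel_measurable M" "v \<in> borel_measurable M" "g \<in> borel_measurable M"
    using u v g by (auto simp: nonneg_Lp_def Lp_def)
  have part: "(\<lambda>x. g x * of_real (w x / (u x + v x))) \<in> Lp_interval p M w"
    if [measurable]: "w \<in> borel_measurable M" and w: "\<And>x. 0 \<le> w x" "\<And>x. w x \<le> u x + v x" for w
  proof -
    have frac: "0 \<le> w x / (u x + v x)" "w x / (u x + v x) \<le> 1" for x
      using w[of x] nn[of x] by (auto simp: divide_le_eq_1)
    have norm_eq: "norm (g x * of_real (w x / (u x + v x))) = norm (g x) * (w x / (u x + v x))" for x
      using frac[of x] by (simp only: norm_mult norm_of_real abs_of_nonneg)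
    have "(\<lambda>x. g x * of_real (w x / (u x + v x))) \<in> Lp p M"
    proof (rule Lp_dominated[OF p0(1) _ g])
      show "AE x in M. norm (g x * of_real (w x / (u x + v x))) \<le> norm (g x)"
        unfolding norm_eq using frac by (intro AE_I2 mult_left_le) auto
    qed measurable
    moreover have "AE x in M. norm (g x * of_real (w x / (u x + v x))) \<le> w x"
      using le
    proof eventually_elim
      case (elim x)
      have "norm (g x) * (w x / (u x + v x)) \<le> (u x + v x) * (w x / (u x + v x))"
        using elim frac by (intro mult_right_mono) auto
      also have "\<dots> \<le> w x" using w by simp
      finally show ?case unfolding norm_eq .
    qed
    ultimately show ?thesis by (simp add: Lp_interval_def)
  qed
  define g1 where "g1 x = g x * of_real (u x / (u x + v x))" for x
  define g2 where "g2 x = g x * of_real (v x / (u x + v x))" for x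
  have g1: "g1 \<in> Lp_interval p M u" and g2: "g2 \<in> Lp_interval p M v"
    unfolding g1_def[abs_def] g2_def[abs_def] by (rule part; simp add: nn)+
  then have Lp12: "g1 \<in> Lp p M" "g2 \<in> Lp p M" by (auto simp: Lp_interval_def)
  have "AE x in M. g x = g1 x + g2 x"
    using le
  proof eventually_elim
    case (elim x)
    show ?case
    proof (cases "u x + v x = 0")
      case True
      with elim show ?thesis by (simp add: g1_def g2_def)
    next
      case False
      then have "u x / (u x + v x) + v x / (u x + v x) = 1" by (simp flip: add_divide_distrib)
      then show ?thesis
        by (simp add: g1_def g2_def flip: distrib_left of_real_add del: of_real_divide)
    qed
  qed
  from Lp_linear_cong[OF T g Lp_add[OF p0(1) Lp12] this] Lp_linear_add[OF T Lp12]
    B_upper[OF u g1] B_upper[OF v g2]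
  show "AE y in N. norm (T g y) \<le> B u y + B v y"
    by eventually_elim (simp add: norm_triangle_mono)
qed

text \<open>
  If \<open>|g| \<le> u\<close> and \<open>|h| \<le> v\<close>, then \<open>|g + cis q * h| \<le> u + v\<close> for every angle \<open>q\<close>, and aligning the
  arguments of \<open>T g\<close> and \<open>cis q * T h\<close> bounds the sum \<open>|T g| + |T h|\<close>.  The least upper bounds over
  \<open>g\<close> and over \<open>h\<close> are then taken one after the other.
\<close>

lemma B_superadditive:
  assumes u: "u \<in> nonneg_Lp p M" and v: "v \<in> nonneg_Lp p M"
  shows "AE y in N. B u y + B v y \<le> B (\<lambda>x. u x + v x) y"
proof -
  let ?S = "B (\<lambda>x. u x + v x)"
  have uv: "(\<lambda>x. u x + v x) \<in> nonneg_Lp p M" by (intro nonneg_Lp_add p0 u v)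
  have pair: "AE y in N. norm (T g y) + norm (T h y) \<le> ?S y"
    if g: "g \<in> Lp_interval p M u" and h: "h \<in> Lp_interval p M v" for g h
  proof -
    have gh: "g \<in> Lp p M" "h \<in> Lp p M" "AE x in M. norm (g x) \<le> u x" "AE x in M. norm (h x) \<le> v x"
      using g h by (auto simp: Lp_interval_def)
    have "AE y in N. norm (T g y + cis q * T h y) \<le> ?S y" for q
    proof -
      have "(\<lambda>x. g x + cis q * h x) \<in> Lp_interval p M (\<lambda>x. u x + v x)"
        unfolding Lp_interval_def
      proof (intro CollectI conjI)
        show "(\<lambda>x. g x + cis q * h x) \<in> Lp p M" by (intro Lp_add Lp_cmult p0 gh)
        show "AE x in M. norm (g x + cis q * h x) \<le> u x + v x"
          using gh(3,4) by eventually_elim (rule norm_triangle_mono; simp add: norm_mult)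
      qed
      from B_upper[OF uv this] Lp_linear_add[OF T gh(1) Lp_cmult[OF gh(2)], of "cis q"]
        Lp_linear_cmult[OF T gh(2), of "cis q"]
      show ?thesis by eventually_elim simp
    qed
    then have "AE y in N. \<forall>q\<in>\<rat>. norm (T g y + cis q * T h y) \<le> ?S y"
      by (simp add: AE_ball_countable countable_rat)
    then show ?thesis by eventually_elim (blast intro: sum_norms_le_from_rotations)
  qed
  have "AE y in N. B u y \<le> ?S y - norm (T h y)" if "h \<in> Lp_interval p M v" for h
    by (rule B_least[OF u]) (use pair[OF _ that] in \<open>auto elim!: eventually_mono simp: algebra_simps\<close>)
  then have "AE y in N. B v y \<le> ?S y - B u y"
    by (intro B_least[OF v]) (auto elim!: eventually_mono simp: algebra_simps)
  then show ?thesis by eventually_elim (simp add: algebra_simps)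
qed

lemma B_add:
  assumes u: "u \<in> nonneg_Lp p M" and v: "v \<in> nonneg_Lp p M"
  shows "AE y in N. B (\<lambda>x. u x + v x) y = B u y + B v y"
  using B_subadditive[OF u v] B_superadditive[OF u v] by eventually_elim simp

definition B_real :: "('a \<Rightarrow> real) \<Rightarrow> 'b \<Rightarrow> real" where
  "B_real r y = B (\<lambda>x. max 0 (r x)) y - B (\<lambda>x. max 0 (- r x)) y"

definition B_complex :: "('a \<Rightarrow> complex) \<Rightarrow> 'b \<Rightarrow> complex" where
  "B_complex f y = Complex (B_real (\<lambda>x. Re (f x)) y) (B_real (\<lambda>x. Im (f x)) y)"

abbreviation real_Lp :: "('a \<Rightarrow> real) \<Rightarrow> bool" where
  "real_Lp r \<equiv> (\<lambda>x. complex_of_real (r x)) \<in> Lp p M"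

lemmas parts = nonneg_Lp_positive_part[OF p0(1)]

lemma B_real_add:
  assumes r: "real_Lp r" and s: "real_Lp s"
  shows "AE y in N. B_real (\<lambda>x. r x + s x) y = B_real r y + B_real s y"
proof -
  have rs: "real_Lp (\<lambda>x. r x + s x)" using Lp_add[OF p0(1) r s] by simp
  note P = parts[OF r] parts[OF s] parts[OF rs]
  \<comment> \<open>the two decompositions of \<open>r + s\<close>, rearranged into an identity between nonnegative functions,
    where additivity of \<open>B\<close> applies\<close>
  have eq: "(\<lambda>x. max 0 (r x + s x) + (max 0 (- r x) + max 0 (- s x))) =
        (\<lambda>x. max 0 (- (r x + s x)) + (max 0 (r x) + max 0 (s x)))"
    by (auto simp: max_def)
  note L = B_add[OF P(5) nonneg_Lp_add[OF p0(1) P(2,4)], unfolded eq] B_add[OF P(2,4)]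
    B_add[OF P(6) nonneg_Lp_add[OF p0(1) P(1,3)]] B_add[OF P(1,3)]
  show ?thesis using L by eventually_elim (simp add: B_real_def)
qed

lemma B_real_cmult:
  assumes r: "real_Lp r"
  shows "AE y in N. B_real (\<lambda>x. a * r x) y = a * B_real r y"
proof (cases "0 \<le> a")
  case True
  have scale: "max 0 (a * t) = a * max 0 t" "max 0 (- (a * t)) = a * max 0 (- t)" for t
    using True by (auto simp: max_def mult_le_0_iff zero_le_mult_iff)
  from B_cmult[OF True parts(1)[OF r]] B_cmult[OF True parts(2)[OF r]]
  show ?thesis unfolding B_real_def scale by eventually_elim (simp add: algebra_simps)
next
  case False
  then have a: "0 \<le> - a" by simp
  have scale: "max 0 (a * t) = - a * max 0 (- t)" "max 0 (- (a * t)) = - a * max 0 t" for t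
    using False by (auto simp: max_def mult_le_0_iff zero_le_mult_iff)
  from B_cmult[OF a parts(1)[OF r]] B_cmult[OF a parts(2)[OF r]]
  show ?thesis unfolding B_real_def scale by eventually_elim (simp add: algebra_simps)
qed

lemma B_real_cong:
  assumes r: "real_Lp r" and s: "real_Lp s" and eq: "AE x in M. r x = s x"
  shows "AE y in N. B_real r y = B_real s y"
proof -
  have "AE x in M. max 0 (r x) = max 0 (s x)" "AE x in M. max 0 (- r x) = max 0 (- s x)"
    using eq by (auto elim: eventually_mono)
  from B_cong[OF parts(1)[OF r] parts(1)[OF s] this(1)]
    B_cong[OF parts(2)[OF r] parts(2)[OF s] this(2)]
  show ?thesis by eventually_elim (simp add: B_real_def)
qed

lemma B_real_in:
  assumes r: "real_Lp r" shows "(\<lambda>y. complex_of_real (B_real r y)) \<in> Lp p N"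
  using Lp_add[OF p0(1) nonneg_Lp_of_real[OF B_in[OF parts(1)[OF r]]]
      Lp_cmult[OF nonneg_Lp_of_real[OF B_in[OF parts(2)[OF r]]], of "-1"]]
  by (simp add: B_real_def)

lemma B_real_nonneg:
  assumes u: "u \<in> nonneg_Lp p M"
  shows "AE y in N. B_real u y = B u y"
proof -
  have z: "(\<lambda>_. 0) \<in> nonneg_Lp p M" using nonneg_Lp_cmult[OF order_refl u] by simp
  have "(\<lambda>x. max 0 (u x)) = u" "(\<lambda>x. max 0 (- u x)) = (\<lambda>_. 0)"
    using u by (auto simp: nonneg_Lp_def)
  with B_cmult[OF order_refl z] show ?thesis by (simp add: B_real_def)
qed

lemma B_complex_linear: "Lp_linear p M N B_complex"
  unfolding Lp_linear_def
proof (intro conjI ballI allI impI)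
  fix f assume f: "f \<in> Lp p M"
  note ri = Lp_Re[OF p0(1) f] Lp_Im[OF p0(1) f]
  show "B_complex f \<in> Lp p N"
    using Lp_add[OF p0(1) B_real_in[OF ri(1)] Lp_cmult[OF B_real_in[OF ri(2)], of \<i>]]
    by (simp add: B_complex_def[abs_def] Complex_eq)
  fix g assume g: "g \<in> Lp p M"
  note ri' = Lp_Re[OF p0(1) g] Lp_Im[OF p0(1) g]
  from B_real_add[OF ri(1) ri'(1)] B_real_add[OF ri(2) ri'(2)]
  show "AE y in N. B_complex (\<lambda>x. f x + g x) y = B_complex f y + B_complex g y"
    by eventually_elim (simp add: B_complex_def complex_eq_iff)
  assume "AE x in M. f x = g x"
  then have "AE x in M. Re (f x) = Re (g x)" "AE x in M. Im (f x) = Im (g x)"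
    by (auto elim: eventually_mono)
  from B_real_cong[OF ri(1) ri'(1) this(1)] B_real_cong[OF ri(2) ri'(2) this(2)]
  show "AE y in N. B_complex f y = B_complex g y" by eventually_elim (simp add: B_complex_def)
next
  fix a f assume f: "f \<in> Lp p M"
  note ri = Lp_Re[OF p0(1) f] Lp_Im[OF p0(1) f]
  have scaled: "real_Lp (\<lambda>x. t * r x)" if "real_Lp r" for t r
    using Lp_cmult[OF that, of "of_real t"] by simp
  from B_real_cmult[OF ri(1), of "Re a"] B_real_cmult[OF ri(1), of "Im a"]
    B_real_cmult[OF ri(2), of "- Im a"] B_real_cmult[OF ri(2), of "Re a"]
    B_real_add[OF scaled[OF ri(1), of "Re a"] scaled[OF ri(2), of "- Im a"]]
    B_real_add[OF scaled[OF ri(2), of "Re a"] scaled[OF ri(1), of "Im a"]]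
  show "AE y in N. B_complex (\<lambda>x. a * f x) y = a * B_complex f y"
    by eventually_elim (simp add: B_complex_def complex_eq_iff algebra_simps)
qed

lemma B_complex_nonneg:
  assumes f: "f \<in> Lp p M" and nn: "AE x in M. 0 \<le> f x"
  shows "(\<lambda>x. max 0 (Re (f x))) \<in> nonneg_Lp p M"
    and "AE x in M. f x = of_real (max 0 (Re (f x)))"
    and "AE y in N. B_complex f y = of_real (B (\<lambda>x. max 0 (Re (f x))) y)"
proof -
  let ?u = "\<lambda>x. max 0 (Re (f x))"
  note ri = Lp_Re[OF p0(1) f] Lp_Im[OF p0(1) f]
  show u: "?u \<in> nonneg_Lp p M" by (rule parts(1)[OF ri(1)])
  show "AE x in M. f x = of_real (max 0 (Re (f x)))"
    using nn by eventually_elim (simp add: complex_nonneg_iff complex_eq_iff)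
  have re: "AE x in M. Re (f x) = ?u x" and im: "AE x in M. Im (f x) = 0 * Re (f x)"
    using nn by (auto elim!: eventually_mono simp: complex_nonneg_iff)
  have z: "real_Lp (\<lambda>x. 0 * Re (f x))" by (simp add: Lp_zero)
  from B_real_cong[OF ri(1) nonneg_Lp_of_real[OF u] re] B_real_nonneg[OF u]
    B_real_cong[OF ri(2) z im] B_real_cmult[OF ri(1), of 0]
  show "AE y in N. B_complex f y = of_real (B ?u y)"
    by eventually_elim (simp add: B_complex_def complex_eq_iff)
qed

text \<open>
  Each of the four parts of \<open>f\<close> is dominated by \<open>|f|\<close>.  The crude constant \<open>4\<close> suffices
  for finiteness of the operator norm.
\<close>

lemma B_complex_norm_le:
  assumes f: "f \<in> Lp p M"
  shows "AE y in N. norm (B_complex f y) \<le> 4 * B (\<lambda>x. norm (f x)) y"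
proof -
  note ri = Lp_Re[OF p0(1) f] Lp_Im[OF p0(1) f]
  note P = parts[OF ri(1)] parts[OF ri(2)]
  have n: "(\<lambda>x. norm (f x)) \<in> nonneg_Lp p M" by (rule nonneg_Lp_norm[OF p0(1) f])
  have part: "AE y in N. B u y \<le> B (\<lambda>x. norm (f x)) y"
    if "u \<in> nonneg_Lp p M" "\<And>x. u x \<le> norm (f x)" for u
    using that n by (intro B_mono) auto
  have bd: "max 0 (Re z) \<le> norm z" "max 0 (- Re z) \<le> norm z"
      "max 0 (Im z) \<le> norm z" "max 0 (- Im z) \<le> norm z" for z :: complex
    using abs_Re_le_cmod[of z] abs_Im_le_cmod[of z] by auto
  from part[OF P(1) bd(1)] part[OF P(2) bd(2)] part[OF P(3) bd(3)] part[OF P(4) bd(4)]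
  show ?thesis
  proof eventually_elim
    case (elim y)
    have "norm (B_complex f y) \<le> \<bar>B_real (\<lambda>x. Re (f x)) y\<bar> + \<bar>B_real (\<lambda>x. Im (f x)) y\<bar>"
      using cmod_le[of "B_complex f y"] by (simp add: B_complex_def)
    with elim B_nonneg[OF P(1), of y] B_nonneg[OF P(2), of y] B_nonneg[OF P(3), of y]
      B_nonneg[OF P(4), of y]
    show ?case by (simp add: B_real_def)
  qed
qed

lemma B_complex_bounded: "Lp_opnorm p M N B_complex < \<infinity>"
proof -
  define C where "C = 4 * c powr (1 / p)"
  have C: "0 \<le> C" "C powr p = 4 powr p * c" using c p0 by (auto simp: C_def powr_mult powr_powr)
  have "ennreal (Lp_norm p N (B_complex f)) \<le> ennreal C * ennreal (Lp_norm p M f)" if f: "f \<in> Lp p M" for f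
  proof -
    let ?n = "\<lambda>x. norm (f x)"
    have n: "?n \<in> nonneg_Lp p M" by (rule nonneg_Lp_norm[OF p0(1) f])
    have "(\<integral>y. norm (B_complex f y) powr p \<partial>N) \<le> (\<integral>y. 4 powr p * B ?n y powr p \<partial>N)"
    proof (rule integral_mono_AE')
      show "integrable N (\<lambda>y. 4 powr p * B ?n y powr p)"
        using B_in[OF n] by (simp add: nonneg_Lp_def)
      show "AE y in N. norm (B_complex f y) powr p \<le> 4 powr p * B ?n y powr p"
        using B_complex_norm_le[OF f]
      proof eventually_elim
        case (elim y)
        then have "norm (B_complex f y) powr p \<le> (4 * B ?n y) powr p" using p0 by (intro powr_mono2) auto
        then show ?case using B_nonneg[OF n] by (simp add: powr_mult)
      qed
    qed simp
    also have "\<dots> \<le> 4 powr p * (c * (\<integral>x. ?n x powr p \<partial>M))"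
      using B_bound[OF n] by (simp add: mult_left_mono)
    also have "\<dots> \<le> (C * Lp_norm p M f) powr p"
      using C p0 by (simp add: powr_mult Lp_norm_nonneg)
        (simp add: Lp_norm_def powr_powr integral_nonneg_AE mult.assoc)
    finally have "Lp_norm p N (B_complex f) \<le> C * Lp_norm p M f"
      using p0 C by (subst Lp_norm_le_iff) (auto intro: mult_nonneg_nonneg Lp_norm_nonneg)
    then show ?thesis
      using C(1) by (simp add: ennreal_mult[symmetric] Lp_norm_nonneg ennreal_leI)
  qed
  then have "Lp_opnorm p M N B_complex \<le> ennreal C" unfolding Lp_opnorm_def by (intro Inf_lower) auto
  then show ?thesis by (rule order_le_less_trans) simp
qed

lemma is_modulus_B_complex: "is_modulus p M N T B_complex"
  unfolding is_modulus_def
proof (intro conjI ballI impI)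
  show "Lp_linear p M N B_complex" by (rule B_complex_linear)
  show "Lp_opnorm p M N B_complex < \<infinity>" by (rule B_complex_bounded)
  show "Lp_positive p M N B_complex"
    unfolding Lp_positive_def
  proof (intro ballI impI)
    fix f assume "f \<in> Lp p M" "AE x in M. 0 \<le> f x"
    from B_complex_nonneg(1,3)[OF this] show "AE y in N. 0 \<le> B_complex f y"
      by (auto elim!: eventually_mono simp: complex_nonneg_iff B_nonneg)
  qed
  fix f assume f: "f \<in> Lp p M" "AE x in M. 0 \<le> f x"
  let ?u = "\<lambda>x. max 0 (Re (f x))"
  note u = B_complex_nonneg[OF f]
  have interval: "g \<in> Lp_interval p M ?u \<longleftrightarrow> g \<in> Lp p M \<and> (AE x in M. of_real (norm (g x)) \<le> f x)" for g
  proof -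
    have "(AE x in M. norm (g x) \<le> ?u x) \<longleftrightarrow> (AE x in M. of_real (norm (g x)) \<le> f x)"
    proof (rule eventually_cong[OF u(2)])
      fix x assume "f x = of_real (?u x)"
      then have "Re (f x) = ?u x" "Im (f x) = 0" by (metis Re_complex_of_real, metis Im_complex_of_real)
      then show "norm (g x) \<le> ?u x \<longleftrightarrow> of_real (norm (g x)) \<le> f x"
        by (simp add: of_real_le_complex_iff)
    qed
    then show ?thesis by (simp add: Lp_interval_def)
  qed
  {
    fix g assume g: "g \<in> Lp p M" "AE x in M. of_real (norm (g x)) \<le> f x"
    then have "AE y in N. norm (T g y) \<le> B ?u y"
      by (intro B_upper u(1)) (simp add: interval)
    with u(3) show "AE y in N. of_real (norm (T g y)) \<le> B_complex f y"
      by eventually_elim (simp add: less_eq_complex_def)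
  next
    fix h :: "'b \<Rightarrow> complex"
    assume h: "\<forall>g\<in>Lp p M. (AE x in M. of_real (norm (g x)) \<le> f x) \<longrightarrow>
      (AE y in N. of_real (norm (T g y)) \<le> h y)"
    then have *: "AE y in N. of_real (norm (T g y)) \<le> h y" if "g \<in> Lp_interval p M ?u" for g
      using that by (simp add: interval)
    have "AE y in N. B ?u y \<le> Re (h y)"
      by (rule B_least[OF u(1)]) (use * in \<open>auto elim!: eventually_mono simp: of_real_le_complex_iff\<close>)
    moreover have "(\<lambda>_. 0) \<in> Lp_interval p M ?u" by (simp add: Lp_interval_def Lp_zero)
    from *[OF this] have "AE y in N. Im (h y) = 0"
      by eventually_elim (simp add: of_real_le_complex_iff)
    ultimately show "AE y in N. B_complex f y \<le> h y"
      using u(3) by eventually_elim (simp add: less_eq_complex_def)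
  }
qed

end

lemma regular_operator_has_modulus:
  assumes p: "1 \<le> p" and reg: "regular_operator p M N T"
  shows "\<exists>A. is_modulus p M N T A"
proof -
  have T: "Lp_linear p M N T" using reg by (simp add: regular_operator_def)
  have p0: "0 < p" using p by simp
  obtain c where c: "0 \<le> c"
    "\<And>u n g. u \<in> nonneg_Lp p M \<Longrightarrow> (\<And>i. i < n \<Longrightarrow> g i \<in> Lp_interval p M u) \<Longrightarrow>
      (\<integral>y. coordinate_max n (\<lambda>i. T (g i) y) powr p \<partial>N) \<le> c * (\<integral>x. u x powr p \<partial>M)"
    using regular_maximal_bound[OF p0 reg] by blast
  have "\<forall>u\<in>nonneg_Lp p M. \<exists>w\<in>nonneg_Lp p N.
    (\<forall>g\<in>Lp_interval p M u. AE y in N. norm (T g y) \<le> w y) \<and>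
    (\<forall>k. (\<forall>g\<in>Lp_interval p M u. AE y in N. norm (T g y) \<le> k y) \<longrightarrow> (AE y in N. w y \<le> k y)) \<and>
    (\<integral>y. w y powr p \<partial>N) \<le> c * (\<integral>x. u x powr p \<partial>M)"
    using c(2) by (intro ballI modulus_value_exists[OF p0 T]) (auto simp: nonneg_Lp_def)
  from bchoice[OF this[unfolded Bex_def]] obtain B where "\<And>u. u \<in> nonneg_Lp p M \<Longrightarrow> B u \<in> nonneg_Lp p N \<and>
    (\<forall>g\<in>Lp_interval p M u. AE y in N. norm (T g y) \<le> B u y) \<and>
    (\<forall>k. (\<forall>g\<in>Lp_interval p M u. AE y in N. norm (T g y) \<le> k y) \<longrightarrow> (AE y in N. B u y \<le> k y)) \<and>
    (\<integral>y. B u y powr p \<partial>N) \<le> c * (\<integral>x. u x powr p \<partial>M)"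
    by blast
  then interpret cone_modulus p M N T B c
    using p T c(1) by unfold_locales auto
  show ?thesis using is_modulus_B_complex by blast
qed

section \<open>The modulus attains the decomposable norm\<close>

theorem theorem3p27:
  fixes \<Omega> :: "'a measure" and \<Omega>' :: "'b measure"
    and p :: real
    and T :: "('a \<Rightarrow> complex) \<Rightarrow> 'b \<Rightarrow> complex"
  assumes "localizable \<Omega>" and "localizable \<Omega>'"
    and "1 \<le> p"
    and "regular_operator p \<Omega> \<Omega>' T"
  shows "(\<exists>A. is_modulus p \<Omega> \<Omega>' T A) \<and>
    (\<forall>A. is_modulus p \<Omega> \<Omega>' T A \<longrightarrow>
       completely_positive p \<Omega> \<Omega>' 2 (block_map A T (conj_map T) A) \<and>
       (A, A) \<in> dec_pairs p \<Omega> \<Omega>' T \<and>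
       dec_norm p \<Omega> \<Omega>' T = max (Lp_opnorm p \<Omega> \<Omega>' A) (Lp_opnorm p \<Omega> \<Omega>' A))"
proof (intro conjI allI impI)
  show "\<exists>A. is_modulus p \<Omega> \<Omega>' T A"
    using assms by (intro regular_operator_has_modulus)
  fix A assume A: "is_modulus p \<Omega> \<Omega>' T A"
  show cp: "completely_positive p \<Omega> \<Omega>' 2 (block_map A T (conj_map T) A)"
    using assms A by (intro completely_positive_modulus) (auto simp: regular_operator_def)
  then show pair: "(A, A) \<in> dec_pairs p \<Omega> \<Omega>' T"
    using is_modulus_linear[OF A] by (simp add: dec_pairs_def)
  show "dec_norm p \<Omega> \<Omega>' T = max (Lp_opnorm p \<Omega> \<Omega>' A) (Lp_opnorm p \<Omega> \<Omega>' A)"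
    using assms(3) A pair by (rule dec_norm_eq_modulus)
qed

end
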